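(* Let $d\ge 2$ and let $H$ be an infinite-dimensional Hilbert space. The relation which assigns to a $*$-representation $\rho:O_d\to B(H)$ of the Cuntz algebra $O_d$ the map \[\tau_\rho=(\rho(a_1^* ),\rho(a_2^* ),\ldots,\rho(a_d^* )):H\to H^d\] is a bijection between the set of representations of $O_d$ on $H$ and the set of $d$-fold similarities of $H$. The inverse of this bijection assigns to a $d$-fold similarity $\psi:H\to H^d$ the representation $\rho$ of $O_d$ given by $\rho(a_k)=T_k$, $k=1,\ldots,d$, where \[T_k(\xi)=\psi^{-1}(0,\ldots,0,\xi,0,\ldots,0),\qquad \xi\in H,\] with $\xi$ on the right-hand side placed at the $k$th coordinate of $H^d$.
   Context: The Cuntz algebra $O_d$, $d\ge 2$, is the universal unital $C^*$-algebra generated by $a_1,\ldots,a_d$ subject to $a_k^*a_k=1$ for $k=1,\ldots,d$ and $a_1a_1^*+\cdots+a_da_d^*=1$. Representations of $O_d$ are unital. For a Hilbert space $H$, $H^d=H\oplus\cdots\oplus H$ ($d$ summands) is the Hilbert space direct sum. A $d$-fold similarity of an infinite-dimensional Hilbert space $H$ is an isomorphism of Hilbert spaces (a surjective linear isometry) $\psi:H\to H^d$. *)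

theory Defs
  imports "HOL-Analysis.Analysis" "HOL-Library.Poly_Mapping"
begin

section \<open>Complex Hilbert spaces\<close>

class scaleC = scaleR +
  fixes scaleC :: "complex \<Rightarrow> 'a \<Rightarrow> 'a"  (infixr "*\<^sub>C" 75)

class complex_vector = scaleC + ab_group_add +
  assumes scaleC_add_right: "c *\<^sub>C (x + y) = c *\<^sub>C x + c *\<^sub>C y"
    and scaleC_add_left: "(c + d) *\<^sub>C x = c *\<^sub>C x + d *\<^sub>C x"
    and scaleC_scaleC: "c *\<^sub>C d *\<^sub>C x = (c * d) *\<^sub>C x"
    and scaleC_one: "1 *\<^sub>C x = x"
    and scaleR_scaleC: "scaleR r x = complex_of_real r *\<^sub>C x"
begin

subclass real_vector
  by standard (simp_all add: scaleR_scaleC scaleC_add_right scaleC_add_left scaleC_scaleC scaleC_one)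

end

text \<open>
  The inner product \<open>cinner\<close> is linear in the first argument. The norm, metric and topology are
  those of the underlying real inner product \<open>inner x y = Re (cinner x y)\<close>.
\<close>

class complex_inner = complex_vector + real_inner +
  fixes cinner :: "'a \<Rightarrow> 'a \<Rightarrow> complex"
  assumes cinner_commute: "cinner x y = cnj (cinner y x)"
    and cinner_add_left: "cinner (x + y) z = cinner x z + cinner y z"
    and cinner_scaleC_left: "cinner (c *\<^sub>C x) y = c * cinner x y"
    and inner_eq_Re_cinner: "inner x y = Re (cinner x y)"

class chilbert_space = complex_inner + complete_space

instance chilbert_space \<subseteq> banach ..

definition cspan :: "'a::complex_vector set \<Rightarrow> 'a set" where
  "cspan = module.span (scaleC :: complex \<Rightarrow> 'a \<Rightarrow> 'a)"

definition clinear :: "('a::complex_vector \<Rightarrow> 'b::complex_vector) \<Rightarrow> bool" where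
  "clinear f \<longleftrightarrow> (\<forall>x y. f (x + y) = f x + f y) \<and> (\<forall>c x. f (c *\<^sub>C x) = c *\<^sub>C f x)"

text \<open>
  The type \<open>'h ^ 'd\<close> with \<open>CARD('d) = d\<close> is the Hilbert space direct sum of \<open>d\<close> copies of \<open>'h\<close>.
\<close>

instantiation vec :: (complex_vector, finite) complex_vector
begin

definition scaleC_vec :: "complex \<Rightarrow> 'a ^ 'b \<Rightarrow> 'a ^ 'b" where
  "scaleC_vec c x = (\<chi> i. c *\<^sub>C (x $ i))"

instance
  by standard (simp_all add: scaleC_vec_def vec_eq_iff scaleC_add_right scaleC_add_left
      scaleC_scaleC scaleC_one scaleR_scaleC)

end

instantiation vec :: (complex_inner, finite) complex_inner
begin

definition cinner_vec :: "'a ^ 'b \<Rightarrow> 'a ^ 'b \<Rightarrow> complex" where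
  "cinner_vec x y = (\<Sum>i\<in>UNIV. cinner (x $ i) (y $ i))"

instance
proof
  fix x y z :: "'a ^ 'b" and c :: complex
  show "cinner x y = cnj (cinner y x)"
    unfolding cinner_vec_def by (subst cinner_commute) simp
  show "cinner (x + y) z = cinner x z + cinner y z"
    by (simp add: cinner_vec_def cinner_add_left sum.distrib)
  show "cinner (c *\<^sub>C x) y = c * cinner x y"
    by (simp add: cinner_vec_def scaleC_vec_def cinner_scaleC_left sum_distrib_left)
  show "inner x y = Re (cinner x y)"
    by (simp add: cinner_vec_def inner_vec_def inner_eq_Re_cinner)
qed

end

instance vec :: (chilbert_space, finite) chilbert_space ..

lemma norm_scaleC: "norm (c *\<^sub>C x) = cmod c * norm (x :: 'a::complex_inner)"
proof -
  have r: "cinner x (c *\<^sub>C y) = cnj c * cinner x y" for c and x y :: 'a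
    by (subst cinner_commute, simp add: cinner_scaleC_left)
       (subst cinner_commute[of y x], simp)
  have "cinner (c *\<^sub>C x) (c *\<^sub>C x) = (c * cnj c) * cinner x x"
    by (simp add: cinner_scaleC_left r)
  also have "\<dots> = complex_of_real ((cmod c)\<^sup>2) * cinner x x"
    by (simp only: complex_norm_square)
  finally have "inner (c *\<^sub>C x) (c *\<^sub>C x) = (cmod c)\<^sup>2 * inner x x"
    by (simp add: inner_eq_Re_cinner)
  then show ?thesis
    by (simp add: norm_eq_sqrt_inner real_sqrt_mult)
qed

section \<open>Unital C*-algebras\<close>

text \<open>
  The zero algebra is admitted, so that the bounded operators on the zero space form an instance.
\<close>

class unital_cstar_algebra = real_normed_algebra + monoid_mult + complete_space + complex_vector +
  fixes star :: "'a \<Rightarrow> 'a"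
  assumes scaleC_mult_left: "(c *\<^sub>C x) * y = c *\<^sub>C (x * y)"
    and scaleC_mult_right: "x * (c *\<^sub>C y) = c *\<^sub>C (x * y)"
    and norm_scaleC_alg: "norm (c *\<^sub>C x) = cmod c * norm x"
    and star_star: "star (star x) = x"
    and star_add: "star (x + y) = star x + star y"
    and star_scaleC: "star (c *\<^sub>C x) = cnj c *\<^sub>C star x"
    and star_mult: "star (x * y) = star y * star x"
    and cstar_identity: "norm (star x * x) = (norm x)\<^sup>2"

(* Unital *-homomorphisms; continuity is not part of the definition, see star_hom_contractive. *)
definition star_hom :: "('a::unital_cstar_algebra \<Rightarrow> 'b::unital_cstar_algebra) \<Rightarrow> bool" where
  "star_hom \<rho> \<longleftrightarrow> clinear \<rho> \<and> (\<forall>x y. \<rho> (x * y) = \<rho> x * \<rho> y) \<and> (\<forall>x. \<rho> (star x) = star (\<rho> x)) \<and> \<rho> 1 = 1"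

section \<open>Bounded operators on a Hilbert space\<close>

lemma riesz_real:
  fixes f :: "'a::{real_inner, complete_space} \<Rightarrow> real"
  assumes "bounded_linear f"
  shows "\<exists>y. \<forall>x. f x = inner x y"
proof -
  interpret f: bounded_linear f by fact
  define g where "g x = (norm x)\<^sup>2 / 2 - f x" for x
  obtain K where K: "\<And>x. \<bar>f x\<bar> \<le> norm x * K"
    using f.bounded by auto
  have glow: "g x \<ge> - K\<^sup>2 / 2" for x
  proof -
    have "0 \<le> (norm x - K)\<^sup>2" by simp
    then have "norm x * K \<le> (norm x)\<^sup>2 / 2 + K\<^sup>2 / 2" by (simp add: power2_diff)
    then show ?thesis using K[of x] by (simp add: g_def abs_le_iff)
  qed
  define m where "m = Inf (range g)"
  have bdd: "bdd_below (range g)" using glow by (auto intro!: bdd_belowI)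
  have m: "m \<le> g x" for x unfolding m_def using bdd by (auto intro: cInf_lower)
  have "\<exists>x. g x < m + 1 / real (Suc n)" for n
    using cInf_lessD[of "range g" "m + 1 / real (Suc n)"] by (auto simp: m_def)
  then obtain X where X: "\<And>n. g (X n) < m + 1 / real (Suc n)" by metis
  have par: "(norm (x - y))\<^sup>2 / 8 = (g x + g y) / 2 - g ((1/2) *\<^sub>R (x + y))" for x y
    unfolding g_def
    by (simp only: f.add f.scaleR power2_norm_eq_inner inner_add_left inner_add_right inner_diff_left
          inner_diff_right inner_scaleR_left inner_scaleR_right inner_commute[of y x])
       (simp add: field_simps)
  have close: "(norm (X i - X j))\<^sup>2 \<le> 8 / real (Suc N)" if "i \<ge> N" "j \<ge> N" for i j N
  proof -
    define c where "c = 1 / real (Suc N)"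
    have "1 / real (Suc i) \<le> c" "1 / real (Suc j) \<le> c"
      using that by (auto simp: c_def intro!: divide_left_mono)
    then have "g (X i) \<le> m + c" "g (X j) \<le> m + c"
      using X[of i] X[of j] by linarith+
    then have "(g (X i) + g (X j)) / 2 \<le> m + c" by simp
    then have "(norm (X i - X j))\<^sup>2 / 8 \<le> c"
      unfolding par using m[of "(1/2) *\<^sub>R (X i + X j)"] by linarith
    then show ?thesis by (simp add: c_def)
  qed
  have "Cauchy X"
  proof (rule metric_CauchyI)
    fix e :: real assume e: "0 < e"
    obtain N where "8 / e\<^sup>2 < real N" using reals_Archimedean2 by blast
    then have N: "8 / e\<^sup>2 < real (Suc N)" by simp
    have "dist (X i) (X j) < e" if "i \<ge> N" "j \<ge> N" for i j
    proof -
      have "8 / real (Suc N) < e\<^sup>2" using N e by (simp add: field_simps)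
      then have "(norm (X i - X j))\<^sup>2 < e\<^sup>2" using close[OF that] by linarith
      then show ?thesis using e by (simp add: dist_norm power2_less_imp_less)
    qed
    then show "\<exists>M. \<forall>m\<ge>M. \<forall>n\<ge>M. dist (X m) (X n) < e" by blast
  qed
  then obtain y where y: "X \<longlonglongrightarrow> y" using Cauchy_convergent convergent_def by blast
  have "(\<lambda>n. g (X n)) \<longlonglongrightarrow> g y"
    unfolding g_def by (intro tendsto_intros y f.tendsto) auto
  moreover have "(\<lambda>n. m + 1 / real (Suc n)) \<longlonglongrightarrow> m + 0"
    by (intro tendsto_intros LIMSEQ_inverse_real_of_nat[unfolded inverse_eq_divide])
  ultimately have "g y \<le> m + 0"
    by (rule LIMSEQ_le) (use X in \<open>auto intro: less_imp_le\<close>)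
  then have min: "g y \<le> g x" for x using m[of x] by simp
  have "f h = inner h y" for h
  proof (rule ccontr)
    assume ne: "f h \<noteq> inner h y"
    define a where "a = inner h y - f h"
    define n where "n = (norm h)\<^sup>2"
    have n: "n \<ge> 0" by (simp add: n_def)
    define t where "t = - a / (n + 1)"
    have "g (y + t *\<^sub>R h) = g y + t * a + t\<^sup>2 / 2 * n"
      unfolding g_def a_def n_def
      by (simp only: f.add f.scaleR power2_norm_eq_inner inner_add_left inner_add_right inner_scaleR_left inner_scaleR_right inner_commute[of y h])
         (simp add: algebra_simps power2_eq_square)
    then have "0 \<le> t * a + t\<^sup>2 / 2 * n" using min[of "y + t *\<^sub>R h"] by simp
    also have "\<dots> \<le> t * a + t\<^sup>2 * (n + 1) / 2"
      by (simp add: algebra_simps)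
    also have "\<dots> = - (a\<^sup>2 / (n + 1)) / 2"
    proof -
      have tk: "t * (n + 1) = - a" using n by (simp add: t_def)
      have "t * a + t\<^sup>2 * (n + 1) / 2 = t * a + t * (t * (n + 1)) / 2"
        by (simp add: power2_eq_square mult.assoc)
      also have "\<dots> = t * a / 2" unfolding tk by simp
      also have "\<dots> = - (a\<^sup>2 / (n + 1)) / 2" by (simp add: t_def power2_eq_square)
      finally show ?thesis .
    qed
    also have "\<dots> < 0" using ne n by (simp add: a_def)
    finally show False by simp
  qed
  then show ?thesis by blast
qed

lemma cinner_scaleC_right: "cinner x (c *\<^sub>C y) = cnj c * cinner x (y :: 'a::complex_inner)"
  by (subst cinner_commute, simp add: cinner_scaleC_left)
     (subst cinner_commute[of y x], simp)

lemma cinner_eqI_inner: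
  fixes x :: "'a::complex_inner"
  assumes "\<And>c. inner (c *\<^sub>C x) y = inner (c *\<^sub>C u) v"
  shows "cinner x y = cinner u v"
  using assms[of 1] assms[of \<i>]
  by (intro complex_eqI) (simp_all add: inner_eq_Re_cinner cinner_scaleC_left)

lemma blinfun_adjoint_ex:
  fixes T :: "'a::{real_inner, complete_space} \<Rightarrow>\<^sub>L 'a"
  shows "\<exists>S :: 'a \<Rightarrow>\<^sub>L 'a. \<forall>x y. inner (T x) y = inner x (S y)"
proof -
  have "\<exists>z. \<forall>x. inner (T x) y = inner x z" for y
    by (rule riesz_real) (intro bounded_linear_intros)
  then obtain S where S: "\<And>x y. inner (T x) y = inner x (S y)" by metis
  have "bounded_linear S"
  proof (rule bounded_linear_intro)
    fix x y and r :: real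
    show "S (x + y) = S x + S y"
      by (rule vector_eq_rdot[THEN iffD1]) (metis S inner_add_right inner_commute)
    show "S (r *\<^sub>R x) = r *\<^sub>R S x"
      by (rule vector_eq_rdot[THEN iffD1]) (metis S inner_scaleR_right inner_commute)
    show "norm (S x) \<le> norm x * norm T"
    proof (cases "S x = 0")
      case False
      have "norm (S x) * norm (S x) = inner (T (S x)) x"
        by (simp add: S power2_norm_eq_inner flip: power2_eq_square)
      also have "\<dots> \<le> norm (T (S x)) * norm x" by (rule norm_cauchy_schwarz)
      also have "\<dots> \<le> (norm T * norm (S x)) * norm x"
        by (intro mult_right_mono norm_blinfun) auto
      finally show ?thesis using False by (simp add: algebra_simps)
    qed simp
  qed
  then show ?thesis using S by (intro exI[of _ "Blinfun S"]) (simp add: bounded_linear_Blinfun_apply)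
qed

text \<open>
  \<open>B(H)\<close>: the complex linear operators inside the real bounded linear operators, with the operator norm.
\<close>

typedef (overloaded) 'h bop =
  "{T :: 'h::chilbert_space \<Rightarrow>\<^sub>L 'h. \<forall>c x. blinfun_apply T (c *\<^sub>C x) = c *\<^sub>C blinfun_apply T x}"
  morphisms blinfun_of_bop Abs_bop
  by (rule exI[of _ id_blinfun]) simp

setup_lifting type_definition_bop

lift_definition bop_apply :: "'h::chilbert_space bop \<Rightarrow> 'h \<Rightarrow> 'h" is blinfun_apply .

lemma bop_eqI: "(\<And>x. bop_apply S x = bop_apply T x) \<Longrightarrow> S = T"
  by transfer (rule blinfun_eqI)

lemma bounded_linear_scaleC: "bounded_linear (\<lambda>x :: 'a::complex_inner. c *\<^sub>C x)"
  by (rule bounded_linear_intro[of _ "cmod c"])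
     (simp_all add: scaleC_add_right scaleR_scaleC scaleC_scaleC mult.commute norm_scaleC)

lift_definition scaleC_blinfun :: "complex \<Rightarrow> ('h::chilbert_space \<Rightarrow>\<^sub>L 'h) \<Rightarrow> 'h \<Rightarrow>\<^sub>L 'h"
  is "\<lambda>c f x. c *\<^sub>C f x"
  by (rule bounded_linear_compose[OF bounded_linear_scaleC])

(* The adjoint with respect to the real inner product inner agrees, on complex linear operators,
   with the adjoint with respect to cinner; see adj_cinner. *)
definition adj_blinfun :: "('h::chilbert_space \<Rightarrow>\<^sub>L 'h) \<Rightarrow> 'h \<Rightarrow>\<^sub>L 'h" where
  "adj_blinfun T = (SOME S. \<forall>x y. inner (blinfun_apply T x) y = inner x (blinfun_apply S y))"

lemma adj_blinfun: "inner (blinfun_apply T x) y = inner x (adj_blinfun T y)"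
  using someI_ex[OF blinfun_adjoint_ex[of T]] unfolding adj_blinfun_def by blast

lemma scaleC_zero_right: "c *\<^sub>C 0 = (0 :: 'a::complex_vector)"
  using scaleC_add_right[of c 0 "0::'a"] by simp

lemma scaleC_minus_right: "c *\<^sub>C (- x) = - (c *\<^sub>C (x :: 'a::complex_vector))"
  using scaleC_add_right[of c x "- x"] scaleC_zero_right[of c, where 'a='a]
  by (simp add: eq_neg_iff_add_eq_0 add.commute)

lemma scaleC_diff_right: "c *\<^sub>C (x - y) = c *\<^sub>C x - c *\<^sub>C (y :: 'a::complex_vector)"
  using scaleC_add_right[of c x "- y"] by (simp add: scaleC_minus_right)

lemma cinner_eq_imp: "(\<And>x. cinner x y = cinner x z) \<Longrightarrow> y = (z :: 'a::complex_inner)"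
  by (rule vector_eq_rdot[THEN iffD1]) (metis inner_commute inner_eq_Re_cinner)

lemma adj_cinner:
  fixes T :: "'h::chilbert_space \<Rightarrow>\<^sub>L 'h"
  assumes "\<forall>c x. blinfun_apply T (c *\<^sub>C x) = c *\<^sub>C blinfun_apply T x"
  shows "cinner (blinfun_apply T x) y = cinner x (adj_blinfun T y)"
  by (rule cinner_eqI_inner) (simp add: adj_blinfun flip: assms[rule_format])

lemma adj_scaleC:
  fixes T :: "'h::chilbert_space \<Rightarrow>\<^sub>L 'h"
  assumes "\<forall>c x. blinfun_apply T (c *\<^sub>C x) = c *\<^sub>C blinfun_apply T x"
  shows "blinfun_apply (adj_blinfun T) (c *\<^sub>C x) = c *\<^sub>C blinfun_apply (adj_blinfun T) x"
  proof (rule cinner_eq_imp)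
  fix z
  show "cinner z (adj_blinfun T (c *\<^sub>C x)) = cinner z (c *\<^sub>C adj_blinfun T x)"
    unfolding cinner_scaleC_right adj_cinner[OF assms, symmetric] ..
qed

instantiation bop :: (chilbert_space) "{complex_vector, real_normed_algebra, monoid_mult}"
begin

lift_definition zero_bop :: "'a bop" is 0 by (simp add: scaleC_zero_right)
lift_definition one_bop :: "'a bop" is id_blinfun by simp
lift_definition plus_bop :: "'a bop \<Rightarrow> 'a bop \<Rightarrow> 'a bop" is "(+)"
  by (simp add: blinfun.add_left scaleC_add_right)
lift_definition uminus_bop :: "'a bop \<Rightarrow> 'a bop" is uminus
  by (simp add: blinfun.minus_left scaleC_minus_right)
lift_definition minus_bop :: "'a bop \<Rightarrow> 'a bop \<Rightarrow> 'a bop" is "(-)"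
  by (simp add: blinfun.diff_left scaleC_diff_right)
lift_definition times_bop :: "'a bop \<Rightarrow> 'a bop \<Rightarrow> 'a bop" is "(o\<^sub>L)" by simp
lift_definition scaleC_bop :: "complex \<Rightarrow> 'a bop \<Rightarrow> 'a bop" is scaleC_blinfun
  by (simp add: scaleC_blinfun.rep_eq scaleC_scaleC mult.commute)
lift_definition scaleR_bop :: "real \<Rightarrow> 'a bop \<Rightarrow> 'a bop" is scaleR
  by (simp add: blinfun.scaleR_left scaleR_scaleC scaleC_scaleC mult.commute)
lift_definition norm_bop :: "'a bop \<Rightarrow> real" is norm .
definition dist_bop :: "'a bop \<Rightarrow> 'a bop \<Rightarrow> real" where "dist_bop S T = norm (S - T)"
definition sgn_bop :: "'a bop \<Rightarrow> 'a bop" where "sgn_bop T = scaleR (inverse (norm T)) T"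
definition uniformity_bop :: "('a bop \<times> 'a bop) filter" where
  "uniformity_bop = (INF e\<in>{0 <..}. principal {(x, y). dist x y < e})"
definition open_bop :: "'a bop set \<Rightarrow> bool" where
  "open_bop S = (\<forall>x\<in>S. \<forall>\<^sub>F (x', y) in uniformity. x' = x \<longrightarrow> y \<in> S)"

instance
proof
  fix x y z :: "'a bop" and c d :: complex and r s :: real
  show "x + y + z = x + (y + z)" by transfer simp
  show "x + y = y + x" by transfer simp
  show "0 + x = x" by transfer simp
  show "- x + x = 0" by transfer simp
  show "x - y = x + - y" by transfer simp
  show "c *\<^sub>C (x + y) = c *\<^sub>C x + c *\<^sub>C y"
    by transfer (rule blinfun_eqI, simp add: scaleC_blinfun.rep_eq blinfun.add_left scaleC_add_right)
  show "(c + d) *\<^sub>C x = c *\<^sub>C x + d *\<^sub>C x"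
    by transfer (rule blinfun_eqI, simp add: scaleC_blinfun.rep_eq blinfun.add_left scaleC_add_left)
  show "c *\<^sub>C d *\<^sub>C x = (c * d) *\<^sub>C x"
    by transfer (rule blinfun_eqI, simp add: scaleC_blinfun.rep_eq scaleC_scaleC)
  show "1 *\<^sub>C x = x" 
    by transfer (rule blinfun_eqI, simp add: scaleC_blinfun.rep_eq scaleC_one)
  show "r *\<^sub>R x = complex_of_real r *\<^sub>C x" 
    by transfer (rule blinfun_eqI, simp add: scaleC_blinfun.rep_eq blinfun.scaleR_left scaleR_scaleC)
  show "r *\<^sub>R (x + y) = r *\<^sub>R x + r *\<^sub>R y" by transfer (simp add: algebra_simps)
  show "(r + s) *\<^sub>R x = r *\<^sub>R x + s *\<^sub>R x" by transfer (simp add: algebra_simps)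
  show "r *\<^sub>R s *\<^sub>R x = (r * s) *\<^sub>R x" by transfer simp
  show "1 *\<^sub>R x = x" by transfer simp
  show "x * y * z = x * (y * z)" by transfer (rule blinfun_eqI, simp)
  show "(x + y) * z = x * z + y * z" 
    by transfer (rule blinfun_eqI, simp add: blinfun.add_left)
  show "x * (y + z) = x * y + x * z" 
    by transfer (rule blinfun_eqI, simp add: blinfun.add_left blinfun.add_right)
  show "r *\<^sub>R x * y = r *\<^sub>R (x * y)" 
    by transfer (rule blinfun_eqI, simp add: blinfun.scaleR_left)
  show "x * r *\<^sub>R y = r *\<^sub>R (x * y)" 
    by transfer (rule blinfun_eqI, simp add: blinfun.scaleR_left blinfun.scaleR_right)
  show "1 * x = x" by transfer (rule blinfun_eqI, simp)
  show "x * 1 = x" by transfer (rule blinfun_eqI, simp)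
  show "dist x y = norm (x - y)" by (simp add: dist_bop_def)
  show "sgn x = inverse (norm x) *\<^sub>R x" by (simp add: sgn_bop_def)
  show "uniformity = (INF e\<in>{0 <..}. principal {(x, y :: 'a bop). dist x y < e})"
    by (simp add: uniformity_bop_def)
  show "open U = (\<forall>x\<in>U. \<forall>\<^sub>F (x', y) in uniformity. x' = x \<longrightarrow> y \<in> U)" for U :: "'a bop set"
    by (simp add: open_bop_def)
  show "(norm x = 0) = (x = 0)" by transfer simp
  show "norm (x + y) \<le> norm x + norm y" by transfer (rule norm_triangle_ineq)
  show "norm (r *\<^sub>R x) = \<bar>r\<bar> * norm x" by transfer simp
  show "norm (x * y) \<le> norm x * norm y" by transfer (rule norm_blinfun_compose)
qed

end

instantiation bop :: (chilbert_space) unital_cstar_algebra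
begin

lift_definition star_bop :: "'a bop \<Rightarrow> 'a bop" is adj_blinfun
  by (simp add: adj_scaleC)

instance
proof
  fix x y z :: "'a bop" and c d :: complex and r s :: real
  show "c *\<^sub>C x * y = c *\<^sub>C (x * y)" 
    by transfer (rule blinfun_eqI, simp add: scaleC_blinfun.rep_eq)
  show "x * c *\<^sub>C y = c *\<^sub>C (x * y)" 
    by transfer (rule blinfun_eqI, simp add: scaleC_blinfun.rep_eq)
  show "norm (c *\<^sub>C x) = cmod c * norm x"
  proof transfer
    have le: "norm (scaleC_blinfun c x) \<le> cmod c * norm x" for c and x :: "'a \<Rightarrow>\<^sub>L 'a"
      by (rule norm_blinfun_bound)
         (simp_all add: scaleC_blinfun.rep_eq norm_scaleC mult.assoc mult_left_mono norm_blinfun)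
    fix c :: complex and x :: "'a \<Rightarrow>\<^sub>L 'a"
    show "norm (scaleC_blinfun c x) = cmod c * norm x"
    proof (cases "c = 0")
      case True then show ?thesis using le[of 0 x] by simp
    next
      case False
      have "x = scaleC_blinfun (inverse c) (scaleC_blinfun c x)"
        using False by (intro blinfun_eqI) (simp add: scaleC_blinfun.rep_eq scaleC_scaleC scaleC_one)
      then have "norm x \<le> inverse (cmod c) * norm (scaleC_blinfun c x)"
        by (metis le norm_inverse)
      then show ?thesis using le[of c x] False by (simp add: field_simps)
    qed
  qed
  have adjI: "S = T" if "\<And>u v. inner (blinfun_apply S u) v = inner (blinfun_apply T u) v"
    for S T :: "'a \<Rightarrow>\<^sub>L 'a"
    by (rule blinfun_eqI, rule vector_eq_rdot[THEN iffD1]) (use that in auto)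
  have adj: "inner (adj_blinfun T x) y = inner x (blinfun_apply T y)" for T :: "'a \<Rightarrow>\<^sub>L 'a" and x y
    by (metis adj_blinfun inner_commute)
  show "star (star x) = x"
    by transfer (rule adjI, simp add: adj adj_blinfun[symmetric])
  show "star (x + y) = star x + star y"
    by transfer (rule adjI, simp add: adj blinfun.add_left inner_add_left inner_add_right)
  show "star (x * y) = star y * star x"
    by transfer (rule adjI, simp add: adj)
  show "star (c *\<^sub>C x) = cnj c *\<^sub>C star x"
  proof (transfer, rule blinfun_eqI, rule cinner_eq_imp)
    fix c :: complex and x :: "'a \<Rightarrow>\<^sub>L 'a" and u v :: 'a
    assume x: "\<forall>c y. blinfun_apply x (c *\<^sub>C y) = c *\<^sub>C blinfun_apply x y"
    have cx: "\<forall>d y. blinfun_apply (scaleC_blinfun c x) (d *\<^sub>C y) = d *\<^sub>C blinfun_apply (scaleC_blinfun c x) y"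
      by (simp add: x scaleC_blinfun.rep_eq scaleC_scaleC mult.commute)
    show "cinner v (adj_blinfun (scaleC_blinfun c x) u) = cinner v (scaleC_blinfun (cnj c) (adj_blinfun x) u)"
      by (simp add: scaleC_blinfun.rep_eq cinner_scaleC_right cinner_scaleC_left
          adj_cinner[OF x, symmetric] adj_cinner[OF cx, symmetric])
  qed
  show "norm (star x * x) = (norm x)\<^sup>2"
  proof transfer
    fix T :: "'a \<Rightarrow>\<^sub>L 'a"
    have le: "(norm T)\<^sup>2 \<le> norm (adj_blinfun T o\<^sub>L T)" for T :: "'a \<Rightarrow>\<^sub>L 'a"
    proof -
      have "norm T \<le> sqrt (norm (adj_blinfun T o\<^sub>L T))"
      proof (rule norm_blinfun_bound)
        fix x
        have "(norm (T x))\<^sup>2 = inner x ((adj_blinfun T o\<^sub>L T) x)"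
          by (simp add: power2_norm_eq_inner adj_blinfun)
        also have "\<dots> \<le> norm x * norm ((adj_blinfun T o\<^sub>L T) x)" by (rule norm_cauchy_schwarz)
        also have "\<dots> \<le> norm x * (norm (adj_blinfun T o\<^sub>L T) * norm x)"
          by (intro mult_left_mono norm_blinfun) auto
        also have "\<dots> = (sqrt (norm (adj_blinfun T o\<^sub>L T)) * norm x)\<^sup>2"
          by (simp add: power_mult_distrib power2_eq_square)
        finally show "norm (T x) \<le> sqrt (norm (adj_blinfun T o\<^sub>L T)) * norm x"
          by (rule power2_le_imp_le) simp
      qed simp
      then show ?thesis by (metis norm_ge_zero power_mono real_sqrt_pow2)
    qed
    have le2: "norm S \<le> norm (adj_blinfun S)" for S :: "'a \<Rightarrow>\<^sub>L 'a"
    proof (cases "S = 0")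
      case False
      have "norm S * norm S \<le> norm (adj_blinfun S) * norm S"
        using le[of S] norm_blinfun_compose[of "adj_blinfun S" S] by (simp add: power2_eq_square)
      then show ?thesis using False by simp
    qed simp
    have "adj_blinfun (adj_blinfun T) = T"
      by (rule adjI) (simp add: adj adj_blinfun[symmetric])
    then have "norm (adj_blinfun T) \<le> norm T" using le2[of "adj_blinfun T"] by simp
    then have "norm (adj_blinfun T o\<^sub>L T) \<le> norm T * norm T"
      by (meson norm_blinfun_compose mult_right_mono norm_ge_zero order_trans)
    then show "norm (adj_blinfun T o\<^sub>L T) = (norm T)\<^sup>2"
      using le[of T] by (simp add: power2_eq_square)
  qed
  show "convergent X" if X: "Cauchy X" for X :: "nat \<Rightarrow> 'a bop"
  proof -
    define Y where "Y n = blinfun_of_bop (X n)" for n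
    have d: "dist (Y m) (Y n) = dist (X m) (X n)" for m n
      unfolding dist_bop_def Y_def norm_bop.rep_eq minus_bop.rep_eq dist_norm ..
    have "Cauchy Y" using X unfolding Cauchy_def d .
    then obtain L where L: "Y \<longlonglongrightarrow> L" by (auto dest!: Cauchy_convergent simp: convergent_def)
    have "blinfun_apply L (c *\<^sub>C x) = c *\<^sub>C blinfun_apply L x" for c x
    proof (rule LIMSEQ_unique)
      show "(\<lambda>n. Y n (c *\<^sub>C x)) \<longlonglongrightarrow> L (c *\<^sub>C x)"
        by (intro tendsto_intros L)
      have "(\<lambda>n. c *\<^sub>C Y n x) \<longlonglongrightarrow> c *\<^sub>C L x"
        by (intro bounded_linear.tendsto[OF bounded_linear_scaleC] tendsto_intros L)
      moreover have "Y n (c *\<^sub>C x) = c *\<^sub>C Y n x" for n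
        using blinfun_of_bop[of "X n"] by (simp add: Y_def)
      ultimately show "(\<lambda>n. Y n (c *\<^sub>C x)) \<longlonglongrightarrow> c *\<^sub>C L x" by simp
    qed
    then have "blinfun_of_bop (Abs_bop L) = L" by (simp add: Abs_bop_inverse)
    then have "dist (X n) (Abs_bop L) = dist (Y n) L" for n
      by (simp only: dist_bop_def Y_def norm_bop.rep_eq minus_bop.rep_eq dist_norm)
    then have "X \<longlonglongrightarrow> Abs_bop L" using L by (simp add: LIMSEQ_def)
    then show ?thesis by (rule convergentI)
  qed
qed

end

section \<open>The Cuntz algebra\<close>

text \<open>
  The universal C*-algebra of the Cuntz relations is obtained in the standard way: the free unital
  complex *-algebra on generators indexed by \<open>'d\<close> carries a largest C*-seminorm among those that
  vanish on the relators, and the Cuntz algebra is the (Hausdorff) completion for this seminorm.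
  The universal property among all unital C*-algebras is proved in \<open>cuntz_universal\<close> below.

  The free *-algebra is the algebra of the free monoid on the letters \<open>(k, False)\<close>, standing for
  the generator \<open>a\<^sub>k\<close>, and \<open>(k, True)\<close>, standing for its adjoint.
\<close>

datatype 'd starword = Word (letters: "('d \<times> bool) list")

(* Written additively because the product of poly_mapping is convolution over a monoid_add. *)
instantiation starword :: (type) monoid_add
begin

definition zero_starword :: "'a starword" where "0 = Word []"

definition plus_starword :: "'a starword \<Rightarrow> 'a starword \<Rightarrow> 'a starword" where
  "u + v = Word (letters u @ letters v)"

instance
  by standard (simp_all add: zero_starword_def plus_starword_def)

end

type_synonym 'd free_star = "'d starword \<Rightarrow>\<^sub>0 complex"

definition flip_word :: "'d starword \<Rightarrow> 'd starword" where
  "flip_word w = Word (map (\<lambda>(k, b). (k, \<not> b)) (rev (letters w)))"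

lemma flip_flip [simp]: "flip_word (flip_word w) = w"
  by (cases w) (simp add: flip_word_def rev_map[symmetric] case_prod_unfold comp_def)

lemma flip_eq_iff: "flip_word u = v \<longleftrightarrow> u = flip_word v"
  by auto

lemma flip_plus: "flip_word (u + v) = flip_word v + flip_word u"
  by (simp add: flip_word_def plus_starword_def)

lemma flip_zero [simp]: "flip_word 0 = 0"
  by (simp add: flip_word_def zero_starword_def)

lift_definition fstar :: "'d free_star \<Rightarrow> 'd free_star" is "\<lambda>f w. cnj (f (flip_word w))"
proof -
  fix f :: "'d starword \<Rightarrow> complex" assume "finite {w. f w \<noteq> 0}"
  then have "finite (flip_word ` {w. f w \<noteq> 0})" by simp
  moreover have "{w. cnj (f (flip_word w)) \<noteq> 0} \<subseteq> flip_word ` {w. f w \<noteq> 0}"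
    by (auto simp: image_iff) (metis flip_flip)
  ultimately show "finite {w. cnj (f (flip_word w)) \<noteq> 0}" by (rule rev_finite_subset)
qed

definition fscale :: "complex \<Rightarrow> 'd free_star \<Rightarrow> 'd free_star" where
  "fscale c x = Poly_Mapping.single 0 c * x"

definition fgen :: "'d \<Rightarrow> 'd free_star" where
  "fgen k = Poly_Mapping.single (Word [(k, False)]) 1"

definition cstar_seminorm :: "('d free_star \<Rightarrow> real) \<Rightarrow> bool" where
  "cstar_seminorm p \<longleftrightarrow>
     (\<forall>x y. p (x + y) \<le> p x + p y) \<and>
     (\<forall>c x. p (fscale c x) = cmod c * p x) \<and>
     (\<forall>x y. p (x * y) \<le> p x * p y) \<and>
     (\<forall>x. p (fstar x * x) = (p x)\<^sup>2)"

definition cuntz_seminorm :: "('d::finite free_star \<Rightarrow> real) \<Rightarrow> bool" where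
  "cuntz_seminorm p \<longleftrightarrow> cstar_seminorm p \<and>
     (\<forall>k. p (fstar (fgen k) * fgen k - 1) = 0) \<and>
     p ((\<Sum>k\<in>UNIV. fgen k * fstar (fgen k)) - 1) = 0"

definition fnorm :: "'d::finite free_star \<Rightarrow> real" where
  "fnorm x = (SUP p\<in>{p. cuntz_seminorm p}. p x)"

lemma free_induct [case_names zero add]:
  assumes "P 0" and "\<And>x w c. P x \<Longrightarrow> P (x + Poly_Mapping.single w c)"
  shows "P (x :: 'a \<Rightarrow>\<^sub>0 complex)"
proof (induction x rule: update_induct)
  case const then show ?case using assms(1) by simp
next
  case (update f a b)
  have "Poly_Mapping.update a b f = f + Poly_Mapping.single a b"
    using update by (intro poly_mapping_eqI)
      (auto simp: lookup_update lookup_add lookup_single when_def not_in_keys_iff_lookup_eq_zero)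
  then show ?case using assms(2) update by simp
qed

lemma fstar_add: "fstar (x + y) = fstar x + fstar y"
  by (rule poly_mapping_eqI) (simp add: fstar.rep_eq lookup_add)

lemma fstar_diff: "fstar (x - y) = fstar x - fstar y"
  by (rule poly_mapping_eqI) (simp add: fstar.rep_eq lookup_minus)

lemma fstar_zero [simp]: "fstar 0 = 0"
  by (rule poly_mapping_eqI) (simp add: fstar.rep_eq)

lemma fstar_single: "fstar (Poly_Mapping.single w c) = Poly_Mapping.single (flip_word w) (cnj c)"
  by (rule poly_mapping_eqI) (auto simp: fstar.rep_eq lookup_single when_def)

lemma fstar_one [simp]: "fstar 1 = 1"
  using fstar_single[of 0 1] by simp

lemma fstar_fstar [simp]: "fstar (fstar x) = x"
  by (rule poly_mapping_eqI) (simp add: fstar.rep_eq)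

lemma fstar_mult: "fstar (x * y) = fstar y * fstar x"
proof (induction x rule: free_induct)
  case (add x w c)
  have "fstar (Poly_Mapping.single w c * y) = fstar y * fstar (Poly_Mapping.single w c)"
    by (induction y rule: free_induct)
       (simp_all add: fstar_add distrib_left distrib_right mult_single fstar_single flip_plus mult.commute)
  then show ?case using add by (simp add: fstar_add distrib_left distrib_right)
qed simp

lemma single0_commute: "x * Poly_Mapping.single 0 c = Poly_Mapping.single 0 c * (x :: 'd free_star)"
  by (induction x rule: free_induct)
     (simp_all add: distrib_left distrib_right mult_single mult.commute)

lemma fscale_add_right: "fscale c (x + y) = fscale c x + fscale c y"
  by (simp add: fscale_def distrib_left)

lemma fscale_diff_right: "fscale c (x - y) = fscale c x - fscale c y"
  by (simp add: fscale_def right_diff_distrib)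

lemma fscale_add_left: "fscale (c + d) x = fscale c x + fscale d x"
  by (simp add: fscale_def single_add distrib_right)

lemma fscale_fscale: "fscale c (fscale d x) = fscale (c * d) x"
  by (simp add: fscale_def mult.assoc[symmetric] mult_single)

lemma fscale_one [simp]: "fscale 1 x = x"
  by (simp add: fscale_def)

lemma fscale_zero [simp]: "fscale 0 x = 0"
  by (simp add: fscale_def)

lemma fscale_minus_one: "fscale (- 1) x = - x"
  by (simp add: fscale_def single_uminus)

lemma fscale_mult_left: "fscale c x * y = fscale c (x * y)"
  by (simp add: fscale_def mult.assoc)

lemma fscale_mult_right: "x * fscale c y = fscale c (x * y)"
  by (simp add: fscale_def mult.assoc[symmetric] single0_commute)

lemma fstar_fscale: "fstar (fscale c x) = fscale (cnj c) (fstar x)"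
  by (simp add: fscale_def fstar_mult fstar_single single0_commute)

lemma fscale_single: "fscale c (Poly_Mapping.single w d) = Poly_Mapping.single w (c * d)"
  by (simp add: fscale_def mult_single)

lemma
  assumes "cstar_seminorm p"
  shows cs_add: "p (x + y) \<le> p x + p y"
    and cs_scale: "p (fscale c x) = cmod c * p x"
    and cs_mult: "p (x * y) \<le> p x * p y"
    and cs_star: "p (fstar x * x) = (p x)\<^sup>2"
    and cs_zero: "p 0 = 0"
    and cs_minus: "p (- x) = p x"
    and cs_nonneg: "p x \<ge> 0"
    and cs_one: "p 1 \<le> 1"
    and cs_fstar: "p (fstar x) = p x"
proof -
  have add: "p (x + y) \<le> p x + p y" and scale: "p (fscale c x) = cmod c * p x"
    and mult: "p (x * y) \<le> p x * p y" and star: "p (fstar x * x) = (p x)\<^sup>2" for x y c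
    using assms unfolding cstar_seminorm_def by blast+
  then show "p (x + y) \<le> p x + p y" "p (fscale c x) = cmod c * p x" "p (x * y) \<le> p x * p y"
    "p (fstar x * x) = (p x)\<^sup>2" by blast+
  show z: "p 0 = 0" using scale[of 0 0] by simp
  show m: "p (- x) = p x" for x using scale[of "-1" x] by (simp add: fscale_minus_one)
  show nn: "p x \<ge> 0" for x using add[of x "- x"] by (simp add: z m)
  have "p 1 = (p 1)\<^sup>2" using star[of 1] by simp
  then have "p 1 = 0 \<or> p 1 = 1" by (simp add: power2_eq_square)
  then show "p 1 \<le> 1" by auto
  have le: "p x \<le> p (fstar x)" for x
  proof (cases "p x = 0")
    case False
    have "p x * p x \<le> p (fstar x) * p x" using star[of x] mult[of "fstar x" x] by (simp add: power2_eq_square)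
    then show ?thesis using False nn[of x] by simp
  qed (simp add: nn)
  show "p (fstar x) = p x" using le[of x] le[of "fstar x"] by simp
qed

lemma cuntz_cstar: "cuntz_seminorm p \<Longrightarrow> cstar_seminorm p"
  by (simp add: cuntz_seminorm_def)

lemma cuntz_letter_le:
  assumes "cuntz_seminorm p"
  shows "p (Poly_Mapping.single (Word [(k, b)]) 1) \<le> 1"
proof -
  note c = cuntz_cstar[OF assms]
  have "(p (fgen k))\<^sup>2 = p ((fstar (fgen k) * fgen k - 1) + 1)" by (simp add: cs_star[OF c])
  also have "\<dots> \<le> p (fstar (fgen k) * fgen k - 1) + p 1" by (rule cs_add[OF c])
  also have "\<dots> \<le> 1" using assms cs_one[OF c] by (simp add: cuntz_seminorm_def)
  finally have "(p (fgen k))\<^sup>2 \<le> 1\<^sup>2" by simp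
  then have 1: "p (fgen k) \<le> 1" by (rule power2_le_imp_le) simp
  show ?thesis
  proof (cases b)
    case True
    have "Poly_Mapping.single (Word [(k, b)]) 1 = fstar (fgen k)"
      using True by (simp add: fgen_def fstar_single flip_word_def)
    then show ?thesis using 1 by (simp add: cs_fstar[OF c])
  qed (use 1 in \<open>simp add: fgen_def\<close>)
qed

lemma cuntz_word_le:
  assumes "cuntz_seminorm p"
  shows "p (Poly_Mapping.single w 1) \<le> 1"
proof -
  note c = cuntz_cstar[OF assms]
  have "p (Poly_Mapping.single (Word l) 1) \<le> 1" for l
  proof (induction l)
    case Nil
    then show ?case using cs_one[OF c] by (simp flip: zero_starword_def)
  next
    case (Cons a l)
    obtain k b where a: "a = (k, b)" by fastforce
    have "(Poly_Mapping.single (Word (a # l)) 1 :: 'a free_star) =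
        Poly_Mapping.single (Word [(k, b)]) 1 * Poly_Mapping.single (Word l) 1"
      by (simp add: mult_single plus_starword_def a)
    then have "p (Poly_Mapping.single (Word (a # l)) 1) \<le>
        p (Poly_Mapping.single (Word [(k, b)]) 1) * p (Poly_Mapping.single (Word l) 1)"
      using cs_mult[OF c] by metis
    also have "\<dots> \<le> 1 * 1"
      by (intro mult_mono Cons.IH cuntz_letter_le[OF assms]) (auto simp: cs_nonneg[OF c])
    finally show ?case by simp
  qed
  then show ?thesis by (metis starword.exhaust)
qed

lemma cuntz_bounded: "\<exists>B. \<forall>p. cuntz_seminorm p \<longrightarrow> p x \<le> B"
proof (induction x rule: free_induct)
  case zero
  then show ?case using cs_zero cuntz_cstar by (metis order_refl)
next
  case (add x w c)
  then obtain B where B: "\<And>p. cuntz_seminorm p \<Longrightarrow> p x \<le> B" by blast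
  have "p (x + Poly_Mapping.single w c) \<le> B + cmod c" if p: "cuntz_seminorm p" for p
  proof -
    note cs = cuntz_cstar[OF p]
    have "p (Poly_Mapping.single w c) = cmod c * p (Poly_Mapping.single w 1)"
      using cs_scale[OF cs, of c "Poly_Mapping.single w 1"] by (simp add: fscale_single)
    also have "\<dots> \<le> cmod c * 1" by (intro mult_left_mono cuntz_word_le[OF p]) auto
    finally show ?thesis using cs_add[OF cs, of x "Poly_Mapping.single w c"] B[OF p] by simp
  qed
  then show ?case by blast
qed

lemma cuntz_seminorm_zero: "cuntz_seminorm (\<lambda>x. 0)"
  by (simp add: cuntz_seminorm_def cstar_seminorm_def)

lemma fnorm_upper: "cuntz_seminorm p \<Longrightarrow> p x \<le> fnorm x"
proof -
  assume p: "cuntz_seminorm p"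
  obtain B where "\<And>p. cuntz_seminorm p \<Longrightarrow> p x \<le> B" using cuntz_bounded by blast
  then have "bdd_above ((\<lambda>p. p x) ` {p. cuntz_seminorm p})" by (auto intro!: bdd_aboveI[of _ B])
  then show ?thesis unfolding fnorm_def using p by (intro cSUP_upper) auto
qed

lemma fnorm_least: "(\<And>p. cuntz_seminorm p \<Longrightarrow> p x \<le> B) \<Longrightarrow> fnorm x \<le> B"
  unfolding fnorm_def using cuntz_seminorm_zero by (intro cSUP_least) auto

lemma cuntz_seminorm_fnorm: "cuntz_seminorm (fnorm :: 'd::finite free_star \<Rightarrow> real)"
proof -
  have nn: "fnorm x \<ge> 0" for x :: "'d free_star" using fnorm_upper[OF cuntz_seminorm_zero] .
  have sub: "fnorm (x + y) \<le> fnorm x + fnorm y" for x y :: "'d free_star"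
    by (rule fnorm_least) (meson add_mono cs_add cuntz_cstar fnorm_upper order_trans)
  have mult: "fnorm (x * y) \<le> fnorm x * fnorm y" for x y :: "'d free_star"
    by (rule fnorm_least)
       (meson mult_mono cs_mult cs_nonneg cuntz_cstar fnorm_upper order_trans nn)
  have sle: "fnorm (fscale c x) \<le> cmod c * fnorm x" for c and x :: "'d free_star"
    by (rule fnorm_least) (simp add: cs_scale[OF cuntz_cstar] mult_left_mono fnorm_upper)
  have scale: "fnorm (fscale c x) = cmod c * fnorm x" for c and x :: "'d free_star"
  proof (cases "c = 0")
    case True then show ?thesis using sle[of 0 x] nn[of "fscale 0 x"] by simp
  next
    case False
    have "fnorm x \<le> inverse (cmod c) * fnorm (fscale c x)"
      using sle[of "inverse c" "fscale c x"] False by (simp add: fscale_fscale norm_inverse)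
    then have "cmod c * fnorm x \<le> fnorm (fscale c x)" using False by (simp add: field_simps)
    then show ?thesis using sle[of c x] by simp
  qed
  have star: "fnorm (fstar x * x) = (fnorm x)\<^sup>2" for x :: "'d free_star"
  proof (rule antisym)
    have "p (fstar x * x) \<le> (fnorm x)\<^sup>2" if "cuntz_seminorm p" for p
      using that by (simp add: cs_star[OF cuntz_cstar] power_mono fnorm_upper cs_nonneg[OF cuntz_cstar])
    then show "fnorm (fstar x * x) \<le> (fnorm x)\<^sup>2" by (rule fnorm_least)
    have "p x \<le> sqrt (fnorm (fstar x * x))" if "cuntz_seminorm p" for p
      using fnorm_upper[OF that, of "fstar x * x"]
      by (intro real_le_rsqrt) (simp add: cs_star[OF cuntz_cstar[OF that]])
    then have "fnorm x \<le> sqrt (fnorm (fstar x * x))" by (rule fnorm_least)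
    then have "(fnorm x)\<^sup>2 \<le> (sqrt (fnorm (fstar x * x)))\<^sup>2" using nn by (intro power_mono)
    then show "(fnorm x)\<^sup>2 \<le> fnorm (fstar x * x)" using nn by simp
  qed
  have zeroI: "fnorm x = 0" if "\<And>p. cuntz_seminorm p \<Longrightarrow> p x = 0" for x :: "'d free_star"
    by (rule antisym[OF fnorm_least nn]) (simp add: that)
  show ?thesis
    unfolding cuntz_seminorm_def cstar_seminorm_def
    using sub mult scale star by (auto intro!: zeroI simp: cuntz_seminorm_def)
qed

lemmas fnorm_cs = cuntz_cstar[OF cuntz_seminorm_fnorm]
lemmas fnorm_add = cs_add[OF fnorm_cs]
lemmas fnorm_fscale = cs_scale[OF fnorm_cs]
lemmas fnorm_mult = cs_mult[OF fnorm_cs]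
lemmas fnorm_star_self = cs_star[OF fnorm_cs]
lemmas fnorm_zero [simp] = cs_zero[OF fnorm_cs]
lemmas fnorm_minus [simp] = cs_minus[OF fnorm_cs]
lemmas fnorm_nonneg [simp] = cs_nonneg[OF fnorm_cs]
lemmas fnorm_fstar [simp] = cs_fstar[OF fnorm_cs]

lemma fnorm_minus_commute: "fnorm (x - y) = fnorm (y - x)"
  using fnorm_minus[of "x - y"] by simp

lemma fnorm_triangle_diff: "fnorm (x - z) \<le> fnorm (x - y) + fnorm (y - z)"
  using fnorm_add[of "x - y" "y - z"] by simp

lemma fnorm_diff_abs: "\<bar>fnorm x - fnorm y\<bar> \<le> fnorm (x - y)"
  using fnorm_add[of "x - y" y] fnorm_add[of "y - x" x] by (simp add: fnorm_minus_commute abs_le_iff)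

definition fcauchy :: "(nat \<Rightarrow> 'd::finite free_star) \<Rightarrow> bool" where
  "fcauchy X \<longleftrightarrow> (\<forall>e>0. \<exists>N. \<forall>m\<ge>N. \<forall>n\<ge>N. fnorm (X m - X n) < e)"

definition cuntz_rel :: "(nat \<Rightarrow> 'd::finite free_star) \<Rightarrow> (nat \<Rightarrow> 'd free_star) \<Rightarrow> bool" where
  "cuntz_rel X Y \<longleftrightarrow> fcauchy X \<and> fcauchy Y \<and> (\<lambda>n. fnorm (X n - Y n)) \<longlonglongrightarrow> 0"

lemma tendsto_zero_le:
  fixes f g :: "nat \<Rightarrow> real"
  assumes "g \<longlonglongrightarrow> 0" "\<And>n. 0 \<le> f n" "\<And>n. f n \<le> g n" shows "f \<longlonglongrightarrow> 0"
  using assms by (intro tendsto_sandwich[OF _ _ tendsto_const assms(1)] always_eventually) auto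

lemma Cauchy_diff_null:
  fixes F G :: "nat \<Rightarrow> 'a::real_normed_vector"
  assumes "Cauchy F" "G \<longlonglongrightarrow> 0" shows "Cauchy (\<lambda>n. F n - G n)"
proof (rule CauchyI)
  fix e :: real assume e: "0 < e"
  obtain M where M: "\<And>m n. m \<ge> M \<Longrightarrow> n \<ge> M \<Longrightarrow> norm (F m - F n) < e / 2"
    using CauchyD[OF assms(1), of "e / 2"] e by auto
  obtain N where N: "\<And>m n. m \<ge> N \<Longrightarrow> n \<ge> N \<Longrightarrow> norm (G m - G n) < e / 2"
    using CauchyD[OF LIMSEQ_imp_Cauchy[OF assms(2)], of "e / 2"] e by auto
  have "norm (F m - G m - (F n - G n)) < e" if "m \<ge> max M N" "n \<ge> max M N" for m n
    using norm_triangle_ineq4[of "F m - F n" "G m - G n"] M[of m n] N[of m n] that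
    by (simp add: algebra_simps)
  then show "\<exists>M. \<forall>m\<ge>M. \<forall>n\<ge>M. norm (F m - G m - (F n - G n)) < e" by blast
qed

lemma fcauchy_const [simp]: "fcauchy (\<lambda>n. x)"
  by (simp add: fcauchy_def)

lemma cuntz_rel_refl: "fcauchy X \<Longrightarrow> cuntz_rel X X"
  by (simp add: cuntz_rel_def)

lemma cuntz_rel_trans: "cuntz_rel X Y \<Longrightarrow> cuntz_rel Y Z \<Longrightarrow> cuntz_rel X Z"
proof (unfold cuntz_rel_def, safe)
  assume "(\<lambda>n. fnorm (X n - Y n)) \<longlonglongrightarrow> 0" "(\<lambda>n. fnorm (Y n - Z n)) \<longlonglongrightarrow> 0"
  from tendsto_add[OF this] have "(\<lambda>n. fnorm (X n - Y n) + fnorm (Y n - Z n)) \<longlonglongrightarrow> 0" by simp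
  then show "(\<lambda>n. fnorm (X n - Z n)) \<longlonglongrightarrow> 0"
    by (rule tendsto_zero_le) (auto intro: fnorm_triangle_diff)
qed

quotient_type 'd cuntz = "nat \<Rightarrow> 'd::finite free_star" / partial: cuntz_rel
proof (rule part_equivpI)
  show "\<exists>X :: nat \<Rightarrow> 'd free_star. cuntz_rel X X"
    by (rule exI[of _ "\<lambda>n. 0"]) (simp add: cuntz_rel_refl)
  show "symp (cuntz_rel :: (nat \<Rightarrow> 'd free_star) \<Rightarrow> _)"
    by (auto simp: symp_def cuntz_rel_def fnorm_minus_commute)
  show "transp (cuntz_rel :: (nat \<Rightarrow> 'd free_star) \<Rightarrow> _)"
    by (auto simp: transp_def intro: cuntz_rel_trans)
qed

lemma fcauchy_dominated:
  assumes "fcauchy X" "fcauchy Y" "0 < C"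
    and "\<And>m n. fnorm (Z m - Z n) \<le> C * (fnorm (X m - X n) + fnorm (Y m - Y n))"
  shows "fcauchy Z"
  unfolding fcauchy_def
proof (intro allI impI)
  fix e :: real assume e: "0 < e"
  then have e': "e / (2 * C) > 0" using assms by simp
  obtain M where M: "\<And>m n. m \<ge> M \<Longrightarrow> n \<ge> M \<Longrightarrow> fnorm (X m - X n) < e / (2 * C)"
    using assms(1) e' unfolding fcauchy_def by blast
  obtain N where N: "\<And>m n. m \<ge> N \<Longrightarrow> n \<ge> N \<Longrightarrow> fnorm (Y m - Y n) < e / (2 * C)"
    using assms(2) e' unfolding fcauchy_def by blast
  have "fnorm (Z m - Z n) < e" if "m \<ge> max M N" "n \<ge> max M N" for m n
  proof -
    have "fnorm (X m - X n) + fnorm (Y m - Y n) < e / (2 * C) + e / (2 * C)"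
      using M[of m n] N[of m n] that by simp
    also have "\<dots> = e / C" by simp
    finally have "C * (fnorm (X m - X n) + fnorm (Y m - Y n)) < e"
      using assms(3) by (simp add: field_simps)
    then show ?thesis using assms(4)[of m n] by linarith
  qed
  then show "\<exists>N. \<forall>m\<ge>N. \<forall>n\<ge>N. fnorm (Z m - Z n) < e" by blast
qed

lemma fcauchy_norm_convergent: "fcauchy X \<Longrightarrow> convergent (\<lambda>n. fnorm (X n))"
proof (rule Cauchy_convergent, rule CauchyI)
  fix e :: real assume "fcauchy X" "0 < e"
  then obtain N where "\<forall>m\<ge>N. \<forall>n\<ge>N. fnorm (X m - X n) < e" unfolding fcauchy_def by blast
  then show "\<exists>M. \<forall>m\<ge>M. \<forall>n\<ge>M. norm (fnorm (X m) - fnorm (X n)) < e"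
    using fnorm_diff_abs order_le_less_trans by (metis real_norm_def)
qed

lemma fcauchy_bounded: assumes "fcauchy X" shows "\<exists>B>0. \<forall>n. fnorm (X n) \<le> B"
proof -
  have "Bseq (\<lambda>n. fnorm (X n))"
    using fcauchy_norm_convergent[OF assms] by (rule convergent_imp_Bseq)
  then show ?thesis by (auto simp: Bseq_def)
qed

lemma fcauchy_add: "fcauchy X \<Longrightarrow> fcauchy Y \<Longrightarrow> fcauchy (\<lambda>n. X n + Y n)"
proof (rule fcauchy_dominated[of X Y 1])
  show "fnorm (X m + Y m - (X n + Y n)) \<le> 1 * (fnorm (X m - X n) + fnorm (Y m - Y n))" for m n
    using fnorm_add[of "X m - X n" "Y m - Y n"] by (simp add: algebra_simps)
qed simp_all

lemma fcauchy_minus: "fcauchy X \<Longrightarrow> fcauchy (\<lambda>n. - X n)"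
  by (rule fcauchy_dominated[of X X 1]) (simp_all add: fnorm_minus_commute)

lemma fcauchy_diff: "fcauchy X \<Longrightarrow> fcauchy Y \<Longrightarrow> fcauchy (\<lambda>n. X n - Y n)"
  using fcauchy_add[OF _ fcauchy_minus, of X Y] by simp

lemma fcauchy_scale: "fcauchy X \<Longrightarrow> fcauchy (\<lambda>n. fscale c (X n))"
proof (rule fcauchy_dominated[of X X "cmod c + 1"])
  show "fnorm (fscale c (X m) - fscale c (X n)) \<le> (cmod c + 1) * (fnorm (X m - X n) + fnorm (X m - X n))" for m n
    unfolding fscale_diff_right[symmetric] fnorm_fscale by (intro mult_mono) auto
qed (auto simp: add_nonneg_pos)

lemma fcauchy_fstar: "fcauchy X \<Longrightarrow> fcauchy (\<lambda>n. fstar (X n))"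
  by (rule fcauchy_dominated[of X X 1]) (simp_all flip: fstar_diff)

lemma fmult_diff_le:
  "fnorm (a * b - c * d) \<le> fnorm (a - c) * fnorm b + fnorm c * fnorm (b - d)"
proof -
  have "a * b - c * d = (a - c) * b + c * (b - d)" by (simp add: algebra_simps)
  then have "fnorm (a * b - c * d) \<le> fnorm ((a - c) * b) + fnorm (c * (b - d))" using fnorm_add by metis
  also have "\<dots> \<le> fnorm (a - c) * fnorm b + fnorm c * fnorm (b - d)" by (intro add_mono fnorm_mult)
  finally show ?thesis .
qed

lemma fcauchy_mult:
  assumes "fcauchy X" "fcauchy Y" shows "fcauchy (\<lambda>n. X n * Y n)"
proof -
  obtain A where A: "A > 0" "\<And>n. fnorm (X n) \<le> A" using fcauchy_bounded[OF assms(1)] by blast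
  obtain B where B: "B > 0" "\<And>n. fnorm (Y n) \<le> B" using fcauchy_bounded[OF assms(2)] by blast
  show ?thesis
  proof (rule fcauchy_dominated[of X Y "A + B"])
    fix m n
    have "fnorm (X m * Y m - X n * Y n) \<le> fnorm (X m - X n) * fnorm (Y m) + fnorm (X n) * fnorm (Y m - Y n)"
      by (rule fmult_diff_le)
    also have "\<dots> \<le> fnorm (X m - X n) * (A + B) + (A + B) * fnorm (Y m - Y n)"
      using A B by (intro add_mono mult_mono) (auto intro: order_trans add_nonneg_nonneg less_imp_le
          simp: add_increasing add_increasing2)
    finally show "fnorm (X m * Y m - X n * Y n) \<le> (A + B) * (fnorm (X m - X n) + fnorm (Y m - Y n))"
      by (simp add: algebra_simps)
  qed (use assms A B in auto)
qed

lemma cuntz_rel_add: "cuntz_rel X X' \<Longrightarrow> cuntz_rel Y Y' \<Longrightarrow> cuntz_rel (\<lambda>n. X n + Y n) (\<lambda>n. X' n + Y' n)"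
proof (unfold cuntz_rel_def, safe intro!: fcauchy_add)
  assume "(\<lambda>n. fnorm (X n - X' n)) \<longlonglongrightarrow> 0" "(\<lambda>n. fnorm (Y n - Y' n)) \<longlonglongrightarrow> 0"
  from tendsto_add[OF this] have "(\<lambda>n. fnorm (X n - X' n) + fnorm (Y n - Y' n)) \<longlonglongrightarrow> 0" by simp
  then show "(\<lambda>n. fnorm (X n + Y n - (X' n + Y' n))) \<longlonglongrightarrow> 0"
  proof (rule tendsto_zero_le)
    show "fnorm (X n + Y n - (X' n + Y' n)) \<le> fnorm (X n - X' n) + fnorm (Y n - Y' n)" for n
      using fnorm_add[of "X n - X' n" "Y n - Y' n"] by (simp add: algebra_simps)
  qed simp
qed

lemma cuntz_rel_minus: "cuntz_rel X X' \<Longrightarrow> cuntz_rel (\<lambda>n. - X n) (\<lambda>n. - X' n)"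
  by (auto simp: cuntz_rel_def fcauchy_minus fnorm_minus_commute)

lemma cuntz_rel_diff: "cuntz_rel X X' \<Longrightarrow> cuntz_rel Y Y' \<Longrightarrow> cuntz_rel (\<lambda>n. X n - Y n) (\<lambda>n. X' n - Y' n)"
  using cuntz_rel_add[OF _ cuntz_rel_minus, of X X' Y Y'] by simp

lemma cuntz_rel_scale: "cuntz_rel X X' \<Longrightarrow> cuntz_rel (\<lambda>n. fscale c (X n)) (\<lambda>n. fscale c (X' n))"
  by (auto simp: cuntz_rel_def fcauchy_scale fnorm_fscale tendsto_mult_right_zero simp flip: fscale_diff_right)

lemma cuntz_rel_fstar: "cuntz_rel X X' \<Longrightarrow> cuntz_rel (\<lambda>n. fstar (X n)) (\<lambda>n. fstar (X' n))"
  by (auto simp: cuntz_rel_def fcauchy_fstar simp flip: fstar_diff)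

lemma cuntz_rel_mult: 
  assumes "cuntz_rel X X'" "cuntz_rel Y Y'" shows "cuntz_rel (\<lambda>n. X n * Y n) (\<lambda>n. X' n * Y' n)"
proof -
  have c: "fcauchy X" "fcauchy X'" "fcauchy Y" "fcauchy Y'" 
    and l: "(\<lambda>n. fnorm (X n - X' n)) \<longlonglongrightarrow> 0" "(\<lambda>n. fnorm (Y n - Y' n)) \<longlonglongrightarrow> 0"
    using assms by (auto simp: cuntz_rel_def)
  obtain A where A: "A > 0" "\<And>n. fnorm (X' n) \<le> A" using fcauchy_bounded[OF c(2)] by blast
  obtain B where B: "B > 0" "\<And>n. fnorm (Y n) \<le> B" using fcauchy_bounded[OF c(3)] by blast
  have "(\<lambda>n. fnorm (X n - X' n) * B + A * fnorm (Y n - Y' n)) \<longlonglongrightarrow> 0 * B + A * 0"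
    by (intro tendsto_intros l)
  then have "(\<lambda>n. fnorm (X n - X' n) * B + A * fnorm (Y n - Y' n)) \<longlonglongrightarrow> 0" by simp
  then have "(\<lambda>n. fnorm (X n * Y n - X' n * Y' n)) \<longlonglongrightarrow> 0"
  proof (rule tendsto_zero_le)
    fix n
    show "fnorm (X n * Y n - X' n * Y' n) \<le> fnorm (X n - X' n) * B + A * fnorm (Y n - Y' n)"
      using fmult_diff_le[of "X n" "Y n" "X' n" "Y' n"] A(2)[of n] B(2)[of n]
      by (smt (verit) fnorm_nonneg mult_left_mono mult_right_mono)
  qed simp
  then show ?thesis using c by (simp add: cuntz_rel_def fcauchy_mult)
qed

lemma cuntz_rel_lim: "cuntz_rel X Y \<Longrightarrow> lim (\<lambda>n. fnorm (X n)) = lim (\<lambda>n. fnorm (Y n))"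
proof -
  assume r: "cuntz_rel X Y"
  then have 0: "(\<lambda>n. fnorm (X n - Y n)) \<longlonglongrightarrow> 0" by (simp add: cuntz_rel_def)
  have "(\<lambda>n. fnorm (X n) - fnorm (Y n)) \<longlonglongrightarrow> 0"
    by (rule Lim_null_comparison[OF _ 0]) (simp add: fnorm_diff_abs)
  moreover obtain a b where a: "(\<lambda>n. fnorm (X n)) \<longlonglongrightarrow> a" and b: "(\<lambda>n. fnorm (Y n)) \<longlonglongrightarrow> b"
    using r fcauchy_norm_convergent unfolding cuntz_rel_def convergent_def by metis
  ultimately have "a - b = 0" using tendsto_diff[OF a b] LIMSEQ_unique by blast
  then show ?thesis using a b by (simp add: limI)
qed

lift_definition cuntz_norm :: "'d::finite cuntz \<Rightarrow> real" is "\<lambda>X. lim (\<lambda>n. fnorm (X n))"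
  by (rule cuntz_rel_lim)

instantiation cuntz :: (finite) "{zero, one, plus, minus, uminus, times, scaleC}"
begin

lift_definition zero_cuntz :: "'a cuntz" is "\<lambda>n. 0" by (simp add: cuntz_rel_refl)
lift_definition one_cuntz :: "'a cuntz" is "\<lambda>n. 1" by (simp add: cuntz_rel_refl)
lift_definition plus_cuntz :: "'a cuntz \<Rightarrow> 'a cuntz \<Rightarrow> 'a cuntz" is "\<lambda>X Y n. X n + Y n"
  by (rule cuntz_rel_add)
lift_definition minus_cuntz :: "'a cuntz \<Rightarrow> 'a cuntz \<Rightarrow> 'a cuntz" is "\<lambda>X Y n. X n - Y n"
  by (rule cuntz_rel_diff)
lift_definition uminus_cuntz :: "'a cuntz \<Rightarrow> 'a cuntz" is "\<lambda>X n. - X n"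
  by (rule cuntz_rel_minus)
lift_definition times_cuntz :: "'a cuntz \<Rightarrow> 'a cuntz \<Rightarrow> 'a cuntz" is "\<lambda>X Y n. X n * Y n"
  by (rule cuntz_rel_mult)
lift_definition scaleC_cuntz :: "complex \<Rightarrow> 'a cuntz \<Rightarrow> 'a cuntz" is "\<lambda>c X n. fscale c (X n)"
  by (rule cuntz_rel_scale)
definition scaleR_cuntz :: "real \<Rightarrow> 'a cuntz \<Rightarrow> 'a cuntz" where
  "scaleR_cuntz r x = complex_of_real r *\<^sub>C x"

instance ..

end

lemma cuntz_cases [cases type: cuntz]:
  obtains (abs) X where "x = abs_cuntz X" "fcauchy X"
proof -
  have "cuntz_rel (rep_cuntz x) (rep_cuntz x)" using Quotient_rep_reflp[OF Quotient_cuntz] .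
  then have "fcauchy (rep_cuntz x)" by (simp add: cuntz_rel_def)
  moreover have "x = abs_cuntz (rep_cuntz x)" by (simp add: Quotient_abs_rep[OF Quotient_cuntz])
  ultimately show ?thesis by (rule that[rotated])
qed

lemma abs_cuntz_eq_iff: "fcauchy X \<Longrightarrow> fcauchy Y \<Longrightarrow> abs_cuntz X = abs_cuntz Y \<longleftrightarrow> (\<lambda>n. fnorm (X n - Y n)) \<longlonglongrightarrow> 0"
  using Quotient_rel[OF Quotient_cuntz, of X Y] by (auto simp: cuntz_rel_def)

lemmas cuntz_abs_simps = plus_cuntz.abs_eq[OF cuntz_rel_refl cuntz_rel_refl]
  minus_cuntz.abs_eq[OF cuntz_rel_refl cuntz_rel_refl]
  uminus_cuntz.abs_eq[OF cuntz_rel_refl] times_cuntz.abs_eq[OF cuntz_rel_refl cuntz_rel_refl]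
  scaleC_cuntz.abs_eq[OF cuntz_rel_refl] zero_cuntz.abs_eq one_cuntz.abs_eq

lemmas fcauchy_intros = fcauchy_add fcauchy_diff fcauchy_minus fcauchy_mult fcauchy_scale fcauchy_fstar

lemma cuntz_norm_abs: "fcauchy X \<Longrightarrow> (\<lambda>n. fnorm (X n)) \<longlonglongrightarrow> cuntz_norm (abs_cuntz X)"
  using fcauchy_norm_convergent[of X] convergent_LIMSEQ_iff
  by (auto simp: cuntz_norm.abs_eq[OF cuntz_rel_refl])

instantiation cuntz :: (finite) "{complex_vector, real_normed_algebra, monoid_mult}"
begin

definition norm_cuntz :: "'a cuntz \<Rightarrow> real" where "norm_cuntz x = cuntz_norm x"
definition dist_cuntz :: "'a cuntz \<Rightarrow> 'a cuntz \<Rightarrow> real" where "dist_cuntz x y = norm (x - y)"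
definition sgn_cuntz :: "'a cuntz \<Rightarrow> 'a cuntz" where "sgn_cuntz x = scaleR (inverse (norm x)) x"
definition uniformity_cuntz :: "('a cuntz \<times> 'a cuntz) filter" where
  "uniformity_cuntz = (INF e\<in>{0 <..}. principal {(x, y). dist x y < e})"
definition open_cuntz :: "'a cuntz set \<Rightarrow> bool" where
  "open_cuntz S = (\<forall>x\<in>S. \<forall>\<^sub>F (x', y) in uniformity. x' = x \<longrightarrow> y \<in> S)"

instance
proof
  fix x y z :: "'a cuntz" and c d :: complex and r s :: real
  obtain X where X: "x = abs_cuntz X" "fcauchy X" by (cases x)
  obtain Y where Y: "y = abs_cuntz Y" "fcauchy Y" by (cases y)
  obtain Z where Z: "z = abs_cuntz Z" "fcauchy Z" by (cases z)
  note s = X Y Z cuntz_abs_simps fcauchy_intros scaleR_cuntz_def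
  have norm_abs_cuntz: "(\<lambda>n. fnorm (X n)) \<longlonglongrightarrow> norm (abs_cuntz X)"
    if "fcauchy X" for X :: "nat \<Rightarrow> 'a free_star"
    using cuntz_norm_abs[OF that] by (simp add: norm_cuntz_def)
  show "x + y + z = x + (y + z)" by (simp add: s add.assoc)
  show "x + y = y + x" by (simp add: s add.commute)
  show "0 + x = x" by (simp add: s)
  show "- x + x = 0" by (simp add: s)
  show "x - y = x + - y" by (simp add: s)
  show "c *\<^sub>C (x + y) = c *\<^sub>C x + c *\<^sub>C y" by (simp add: s fscale_add_right)
  show "(c + d) *\<^sub>C x = c *\<^sub>C x + d *\<^sub>C x" by (simp add: s fscale_add_left)
  show "c *\<^sub>C d *\<^sub>C x = (c * d) *\<^sub>C x" by (simp add: s fscale_fscale)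
  show "1 *\<^sub>C x = x" by (simp add: s)
  show "r *\<^sub>R x = complex_of_real r *\<^sub>C x" by (simp add: s)
  show "r *\<^sub>R (x + y) = r *\<^sub>R x + r *\<^sub>R y" by (simp add: s fscale_add_right)
  show "(r + s) *\<^sub>R x = r *\<^sub>R x + s *\<^sub>R x" by (simp add: s fscale_add_left)
  show "r *\<^sub>R s *\<^sub>R x = (r * s) *\<^sub>R x" by (simp add: s fscale_fscale)
  show "1 *\<^sub>R x = x" by (simp add: s)
  show "x * y * z = x * (y * z)" by (simp add: s mult.assoc)
  show "(x + y) * z = x * z + y * z" by (simp add: s distrib_right)
  show "x * (y + z) = x * y + x * z" by (simp add: s distrib_left)
  show "r *\<^sub>R x * y = r *\<^sub>R (x * y)" by (simp add: s fscale_mult_left)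
  show "x * r *\<^sub>R y = r *\<^sub>R (x * y)" by (simp add: s fscale_mult_right)
  show "1 * x = x" by (simp add: s)
  show "x * 1 = x" by (simp add: s)
  show "dist x y = norm (x - y)" by (simp add: dist_cuntz_def)
  show "sgn x = inverse (norm x) *\<^sub>R x" by (simp add: sgn_cuntz_def)
  show "uniformity = (INF e\<in>{0 <..}. principal {(x, y :: 'a cuntz). dist x y < e})"
    by (simp add: uniformity_cuntz_def)
  show "open U = (\<forall>x\<in>U. \<forall>\<^sub>F (x', y) in uniformity. x' = x \<longrightarrow> y \<in> U)" for U :: "'a cuntz set"
    by (simp add: open_cuntz_def)
  note nx = norm_abs_cuntz[OF X(2), folded X(1)] and ny = norm_abs_cuntz[OF Y(2), folded Y(1)]
  show "(norm x = 0) = (x = 0)"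
  proof
    assume "norm x = 0" then show "x = 0" using nx by (simp add: s abs_cuntz_eq_iff)
  next
    assume "x = 0"
    then have "(\<lambda>n. fnorm (X n)) \<longlonglongrightarrow> 0" by (simp add: s abs_cuntz_eq_iff)
    then show "norm x = 0" using nx LIMSEQ_unique by blast
  qed
  show "norm (x + y) \<le> norm x + norm y"
  proof (rule LIMSEQ_le[OF _ tendsto_add[OF nx ny]])
    show "(\<lambda>n. fnorm (X n + Y n)) \<longlonglongrightarrow> norm (x + y)"
      using norm_abs_cuntz[OF fcauchy_add[OF X(2) Y(2)]] by (simp add: s)
  qed (auto intro: fnorm_add)
  show "norm (r *\<^sub>R x) = \<bar>r\<bar> * norm x"
  proof (rule LIMSEQ_unique[OF _ tendsto_mult_left[OF nx]])
    show "(\<lambda>n. \<bar>r\<bar> * fnorm (X n)) \<longlonglongrightarrow> norm (r *\<^sub>R x)"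
      using norm_abs_cuntz[OF fcauchy_scale[OF X(2), of "complex_of_real r"]] by (simp add: s fnorm_fscale)
  qed
  show "norm (x * y) \<le> norm x * norm y"
  proof (rule LIMSEQ_le[OF _ tendsto_mult[OF nx ny]])
    show "(\<lambda>n. fnorm (X n * Y n)) \<longlonglongrightarrow> norm (x * y)"
      using norm_abs_cuntz[OF fcauchy_mult[OF X(2) Y(2)]] by (simp add: s)
  qed (auto intro: fnorm_mult)
qed

end

lemma norm_abs_cuntz: "fcauchy X \<Longrightarrow> (\<lambda>n. fnorm (X n)) \<longlonglongrightarrow> norm (abs_cuntz X)"
  using cuntz_norm_abs by (simp add: norm_cuntz_def)

definition cembed :: "'d::finite free_star \<Rightarrow> 'd cuntz" where
  "cembed a = abs_cuntz (\<lambda>n. a)"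

lemma norm_cembed: "norm (cembed a) = fnorm a"
  using norm_abs_cuntz[OF fcauchy_const, of a] by (simp add: cembed_def LIMSEQ_const_iff)

lemma cembed_simps:
  "cembed (a + b) = cembed a + cembed b" "cembed (a - b) = cembed a - cembed b"
  "cembed (a * b) = cembed a * cembed b" "cembed (fscale c a) = c *\<^sub>C cembed a"
  "cembed 0 = 0" "cembed 1 = 1"
  by (simp_all add: cembed_def cuntz_abs_simps)

lemma cembed_tendsto:
  assumes "fcauchy X" shows "(\<lambda>n. cembed (X n)) \<longlonglongrightarrow> abs_cuntz X"
proof (rule LIMSEQ_I)
  fix e :: real assume "0 < e"
  then obtain N where N: "\<And>m n. m \<ge> N \<Longrightarrow> n \<ge> N \<Longrightarrow> fnorm (X m - X n) < e / 2"
    using assms unfolding fcauchy_def by (meson half_gt_zero)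
  have "norm (cembed (X n) - abs_cuntz X) \<le> e / 2" if "n \<ge> N" for n
  proof (rule LIMSEQ_le_const2)
    show "(\<lambda>m. fnorm (X n - X m)) \<longlonglongrightarrow> norm (cembed (X n) - abs_cuntz X)"
      using norm_abs_cuntz[of "\<lambda>m. X n - X m"] assms by (simp add: cembed_def cuntz_abs_simps fcauchy_intros)
    show "\<exists>M. \<forall>m\<ge>M. fnorm (X n - X m) \<le> e / 2" using N that by (meson less_imp_le)
  qed
  then show "\<exists>N. \<forall>n\<ge>N. norm (cembed (X n) - abs_cuntz X) < e"
    using \<open>0 < e\<close> by (metis field_sum_of_halves less_add_same_cancel1 half_gt_zero order_le_less_trans)
qed

lemma cembed_dense: assumes "e > 0" shows "\<exists>a. norm (x - cembed a) < e"
proof (cases x)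
  case (abs X)
  obtain N where "\<forall>n\<ge>N. norm (cembed (X n) - x) < e"
    using LIMSEQ_D[OF cembed_tendsto[OF abs(2)] assms] abs(1) by blast
  then show ?thesis by (metis norm_minus_commute order_refl)
qed

instantiation cuntz :: (finite) unital_cstar_algebra
begin

lift_definition star_cuntz :: "'a cuntz \<Rightarrow> 'a cuntz" is "\<lambda>X n. fstar (X n)"
  by (rule cuntz_rel_fstar)

instance
proof
  fix x y z :: "'a cuntz" and c d :: complex and r s :: real
  obtain X where X: "x = abs_cuntz X" "fcauchy X" by (cases x)
  obtain Y where Y: "y = abs_cuntz Y" "fcauchy Y" by (cases y)
  note s = X Y cuntz_abs_simps fcauchy_intros star_cuntz.abs_eq[OF cuntz_rel_refl]
  note nx = norm_abs_cuntz[OF X(2), folded X(1)]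
  show "c *\<^sub>C x * y = c *\<^sub>C (x * y)" by (simp add: s fscale_mult_left)
  show "x * c *\<^sub>C y = c *\<^sub>C (x * y)" by (simp add: s fscale_mult_right)
  show "star (star x) = x" by (simp add: s)
  show "star (x + y) = star x + star y" by (simp add: s fstar_add)
  show "star (c *\<^sub>C x) = cnj c *\<^sub>C star x" by (simp add: s fstar_fscale)
  show "star (x * y) = star y * star x" by (simp add: s fstar_mult)
  show "norm (c *\<^sub>C x) = cmod c * norm x"
  proof (rule LIMSEQ_unique[OF _ tendsto_mult_left[OF nx]])
    show "(\<lambda>n. cmod c * fnorm (X n)) \<longlonglongrightarrow> norm (c *\<^sub>C x)"
      using norm_abs_cuntz[OF fcauchy_scale[OF X(2), of c]] by (simp add: s fnorm_fscale)
  qed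
  show "norm (star x * x) = (norm x)\<^sup>2"
  proof (rule LIMSEQ_unique[OF _ tendsto_power[OF nx]])
    show "(\<lambda>n. (fnorm (X n))\<^sup>2) \<longlonglongrightarrow> norm (star x * x)"
      using norm_abs_cuntz[OF fcauchy_mult[OF fcauchy_fstar[OF X(2)] X(2)]] by (simp add: s fnorm_star_self)
  qed
  show "convergent F" if F: "Cauchy F" for F :: "nat \<Rightarrow> 'a cuntz"
  proof -
    have "\<exists>a. norm (F n - cembed a) < inverse (real (Suc n))" for n
      by (rule cembed_dense) simp
    then obtain A where A: "\<And>n. norm (F n - cembed (A n)) < inverse (real (Suc n))" by metis
    have 0: "(\<lambda>n. F n - cembed (A n)) \<longlonglongrightarrow> 0"
      by (rule Lim_null_comparison[OF _ LIMSEQ_inverse_real_of_nat]) (use A in \<open>auto intro!: always_eventually less_imp_le simp del: of_nat_Suc\<close>)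
    have "Cauchy (\<lambda>n. F n - (F n - cembed (A n)))"
      by (rule Cauchy_diff_null[OF F 0])
    then have "Cauchy (\<lambda>n. cembed (A n))" by simp
    then have A': "fcauchy A"
      unfolding Cauchy_def fcauchy_def dist_norm cembed_simps[symmetric] norm_cembed .
    have "(\<lambda>n. F n - cembed (A n) + cembed (A n)) \<longlonglongrightarrow> 0 + abs_cuntz A"
      by (rule tendsto_add[OF 0 cembed_tendsto[OF A']])
    then show ?thesis by (auto simp: convergent_def)
  qed
qed

end

lemma cembed_fstar: "cembed (fstar a) = star (cembed a)"
  by (simp add: cembed_def star_cuntz.abs_eq[OF cuntz_rel_refl])

definition cgen :: "'d::finite \<Rightarrow> 'd cuntz" where
  "cgen k = cembed (fgen k)"

definition cuntz_relations :: "('d::finite \<Rightarrow> 'a::unital_cstar_algebra) \<Rightarrow> bool" where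
  "cuntz_relations a \<longleftrightarrow> (\<forall>k. star (a k) * a k = 1) \<and> (\<Sum>k\<in>UNIV. a k * star (a k)) = 1"

lemma cembed_sum: "cembed (sum f S) = (\<Sum>k\<in>S. cembed (f k))"
  by (induction S rule: infinite_finite_induct) (simp_all add: cembed_simps)

lemma cuntz_relations_cgen: "cuntz_relations (cgen :: 'd::finite \<Rightarrow> 'd cuntz)"
proof -
  have z: "cembed a = cembed b" if "fnorm (a - b) = 0" for a b :: "'d free_star"
    using that norm_cembed[of "a - b"] by (simp add: cembed_simps)
  have 1: "star (cgen k) * cgen k = 1" for k :: 'd
    using z[of "fstar (fgen k) * fgen k" 1] cuntz_seminorm_fnorm[where 'd='d]
    by (simp add: cuntz_seminorm_def cgen_def cembed_simps cembed_fstar)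
  have 2: "(\<Sum>k\<in>UNIV. cgen k * star (cgen k :: 'd cuntz)) = 1"
    using z[of "\<Sum>k\<in>UNIV. fgen k * fstar (fgen k)" 1] cuntz_seminorm_fnorm[where 'd='d]
    by (simp add: cuntz_seminorm_def cgen_def cembed_simps cembed_fstar cembed_sum)
  show ?thesis using 1 2 by (simp add: cuntz_relations_def)
qed

section \<open>The universal property\<close>

instance unital_cstar_algebra \<subseteq> banach ..

lemma scaleC_zero_left: "0 *\<^sub>C x = (0 :: 'a::complex_vector)"
  using scaleC_add_left[of 0 0 x] by simp

context
  fixes x y :: "'a::unital_cstar_algebra"
begin

lemma star_zero: "star 0 = (0 :: 'a)"
  using star_add[of 0 "0 :: 'a"] by simp

lemma star_minus: "star (- x) = - star x"
  using star_add[of x "- x"] by (simp add: star_zero eq_neg_iff_add_eq_0 add.commute)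

lemma star_one: "star 1 = (1 :: 'a)"
  by (metis mult.right_neutral star_mult star_star)

lemma norm_one_le: "norm (1 :: 'a) \<le> 1"
proof -
  have "norm (1 :: 'a) = (norm (1 :: 'a))\<^sup>2" using cstar_identity[of "1 :: 'a"] by (simp add: star_one)
  then show ?thesis by (metis le_numeral_extra(4) mult_cancel_right1 norm_ge_zero order_le_less
        power2_eq_square zero_le_one)
qed

lemma norm_star: "norm (star x) = norm x"
proof -
  have le: "norm x \<le> norm (star x)" for x :: 'a
  proof (cases "norm x = 0")
    case False
    have "norm x * norm x \<le> norm (star x) * norm x"
      using cstar_identity[of x] norm_mult_ineq[of "star x" x] by (simp add: power2_eq_square)
    then show ?thesis using False by (simp add: mult_le_cancel_right)
  qed simp
  show ?thesis using le[of x] le[of "star x"] by (simp add: star_star)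
qed

lemma star_scaleR: "star (r *\<^sub>R x) = r *\<^sub>R star x"
  by (simp add: scaleR_scaleC star_scaleC)

end

lemma bounded_linear_star: "bounded_linear (star :: 'a::unital_cstar_algebra \<Rightarrow> 'a)"
  by (rule bounded_linear_intro[of _ 1]) (simp_all add: star_add star_scaleR norm_star)

lemma norm_power_le:
  "norm (y ^ n) \<le> norm (y :: 'a::unital_cstar_algebra) ^ n"
proof (induction n)
  case (Suc n)
  have "norm (y ^ Suc n) \<le> norm y * norm (y ^ n)" by (simp add: norm_mult_ineq)
  also have "\<dots> \<le> norm y * norm y ^ n" by (intro mult_left_mono Suc.IH) auto
  finally show ?case by simp
qed (simp add: norm_one_le)

lemma star_power: "star (y ^ n) = star (y :: 'a::unital_cstar_algebra) ^ n"
  by (induction n) (simp_all add: star_one star_mult power_commutes)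

lemma gbinomial_half_le: "\<bar>(1/2 :: real) gchoose n\<bar> \<le> 1"
proof (induction n)
  case (Suc n)
  have "(1/2 :: real) gchoose Suc n = ((1/2) gchoose n) * ((1/2 - real n) / (real n + 1))"
    using gbinomial_absorb_comp[of "1/2 :: real" n] gbinomial_absorption[of n "1/2 :: real"]
      gbinomial_mult_1[of "1/2::real" n] by (simp add: field_simps)
  moreover have "\<bar>(1/2 - real n) / (real n + 1)\<bar> \<le> 1" by (simp add: abs_divide abs_le_iff)
  ultimately show ?case using Suc by (metis abs_ge_zero abs_mult mult_le_one)
qed simp

lemma sqrt_exists:
  fixes h :: "'a::unital_cstar_algebra"
  assumes "star h = h" "norm h < 1"
  shows "\<exists>c. star c = c \<and> c * c = 1 - h \<and> (\<forall>a. a * h = h * a \<longrightarrow> a * c = c * a)"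
proof -
  define y where "y = - h"
  define f where "f n = ((1/2 :: real) gchoose n) *\<^sub>R y ^ n" for n
  have ny: "norm y < 1" using assms by (simp add: y_def)
  have sn: "summable (\<lambda>n. norm (f n))"
  proof (rule summable_comparison_test')
    show "summable (\<lambda>n. norm y ^ n)" using ny by (simp add: summable_geometric)
    show "norm (norm (f n)) \<le> norm y ^ n" if "n \<ge> 0" for n
      using mult_mono[OF gbinomial_half_le[of n] norm_power_le[of y n]] by (simp add: f_def)
  qed
  have sf: "summable f" using sn by (rule summable_norm_cancel)
  define c where "c = suminf f"
  have "star c = suminf (\<lambda>n. star (f n))"
    unfolding c_def by (rule bounded_linear.suminf[OF bounded_linear_star sf])
  also have "(\<lambda>n. star (f n)) = f"
    by (rule ext) (simp add: f_def star_scaleR star_power y_def star_minus assms)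
  finally have "star c = c" by (simp add: c_def)
  moreover have "c * c = 1 - h"
  proof -
    have "(\<lambda>k. \<Sum>i\<le>k. f i * f (k - i)) sums (c * c)"
      unfolding c_def by (rule Cauchy_product_sums[OF sn sn])
    moreover have "(\<Sum>i\<le>k. f i * f (k - i)) = ((1 :: real) gchoose k) *\<^sub>R y ^ k" for k
    proof -
      have "(\<Sum>i\<le>k. f i * f (k - i)) = (\<Sum>i\<le>k. (((1/2) gchoose i) * ((1/2) gchoose (k - i))) *\<^sub>R y ^ k)"
        by (rule sum.cong) (auto simp: f_def simp flip: power_add)
      also have "\<dots> = (\<Sum>i\<le>k. ((1/2 :: real) gchoose i) * ((1/2) gchoose (k - i))) *\<^sub>R y ^ k"
        by (rule scaleR_sum_left[symmetric])
      also have "\<dots> = ((1/2 + 1/2 :: real) gchoose k) *\<^sub>R y ^ k"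
        by (subst gbinomial_Vandermonde[symmetric]) (simp add: atMost_atLeast0)
      finally show ?thesis by simp
    qed
    ultimately have 1: "(\<lambda>k. ((1 :: real) gchoose k) *\<^sub>R y ^ k) sums (c * c)" by simp
    have "(1 :: real) gchoose k = 0" if "k \<ge> 2" for k
      using gbinomial_of_nat_symmetric binomial_gbinomial[of 1 k] that
      by (metis binomial_eq_0 of_nat_0 of_nat_1 one_less_numeral_iff order_less_le_trans semiring_norm(76))
    then have "(\<lambda>k. ((1 :: real) gchoose k) *\<^sub>R y ^ k) sums (\<Sum>k<2. ((1 :: real) gchoose k) *\<^sub>R y ^ k)"
      by (intro sums_finite) auto
    then have "c * c = (\<Sum>k<2. ((1 :: real) gchoose k) *\<^sub>R y ^ k)" using 1 sums_unique2 by blast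
    then show ?thesis by (simp add: numeral_2_eq_2 y_def)
  qed
  moreover have "a * c = c * a" if ah: "a * h = h * a" for a
  proof -
    have ay: "a * y ^ n = y ^ n * a" for n
    proof (induction n)
      case (Suc n)
      have "a * y ^ Suc n = (a * y) * y ^ n" by (simp add: mult.assoc)
      also have "\<dots> = y * (a * y ^ n)" using ah by (simp add: y_def mult.assoc)
      finally show ?case using Suc by (simp add: mult.assoc)
    qed simp
    have "a * c = suminf (\<lambda>n. a * f n)" unfolding c_def by (rule bounded_linear.suminf[OF bounded_linear_mult_right sf])
    also have "\<dots> = suminf (\<lambda>n. f n * a)" by (simp add: f_def ay)
    also have "\<dots> = c * a" unfolding c_def
      by (rule bounded_linear.suminf[OF bounded_linear_mult_left sf, symmetric])
    finally show ?thesis .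
  qed
  ultimately show ?thesis by blast
qed

lemma
  assumes "star_hom \<rho>"
  shows star_hom_add: "\<rho> (x + y) = \<rho> x + \<rho> y"
    and star_hom_scaleC: "\<rho> (c *\<^sub>C x) = c *\<^sub>C \<rho> x"
    and star_hom_mult: "\<rho> (x * y) = \<rho> x * \<rho> y"
    and star_hom_star: "\<rho> (star x) = star (\<rho> x)"
    and star_hom_one: "\<rho> 1 = 1"
    and star_hom_scaleR: "\<rho> (r *\<^sub>R x) = r *\<^sub>R \<rho> x"
  using assms by (simp_all add: star_hom_def clinear_def scaleR_scaleC)

lemma star_hom_contractive:
  fixes \<rho> :: "'a::unital_cstar_algebra \<Rightarrow> 'b::unital_cstar_algebra"
  assumes "star_hom \<rho>"
  shows "norm (\<rho> x) \<le> norm x"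
proof -
  note h = star_hom_add[OF assms] star_hom_scaleC[OF assms] star_hom_mult[OF assms]
    star_hom_star[OF assms] star_hom_one[OF assms] star_hom_scaleR[OF assms]
  have unit: "norm (\<rho> u) \<le> 1" if "star u * u = 1" for u
  proof -
    have "(norm (\<rho> u))\<^sup>2 = norm (\<rho> (star u * u))" by (simp add: h cstar_identity)
    also have "\<dots> \<le> 1\<^sup>2" using norm_one_le[where 'a='b] by (simp add: that h)
    finally show ?thesis by (rule power2_le_imp_le) simp
  qed
  have sa1: "norm (\<rho> a) \<le> 1" if a: "star a = a" "norm a < 1" for a
  proof -
    have "norm (a * a) \<le> norm a * norm a" by (rule norm_mult_ineq)
    also have "\<dots> < 1" using a(2) by (metis mult.right_neutral mult_less_cancel_left_pos mult_strict_mono norm_ge_zero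
        order_le_less mult_zero_left zero_less_one)
    finally obtain c where c: "star c = c" "c * c = 1 - a * a" "a * c = c * a"
      using sqrt_exists[of "a * a"] a by (auto simp: star_mult mult.assoc)
    define u where "u = a + \<i> *\<^sub>C c"
    have su: "star u = a + (- \<i>) *\<^sub>C c" by (simp add: u_def star_add star_scaleC a c)
    have "star u * u = a * a + \<i> *\<^sub>C (a * c) + ((- \<i>) *\<^sub>C (a * c) + c * c)"
      unfolding su by (simp add: u_def distrib_left distrib_right scaleC_mult_left scaleC_mult_right c(3)
          scaleC_add_right scaleC_scaleC scaleC_one)
    also have "\<dots> = (\<i> + (- \<i>)) *\<^sub>C (a * c) + (a * a + c * c)"
      unfolding scaleC_add_left by (simp add: algebra_simps)
    also have "\<dots> = a * a + c * c" by (simp add: scaleC_zero_left)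
    finally have "star u * u = a * a + c * c" .
    then have "star u * u = 1" by (simp add: c)
    then have 1: "norm (\<rho> u) \<le> 1" by (rule unit)
    have "(2 :: real) *\<^sub>R a = u + star u"
    proof -
      have "u + star u = a + a + (\<i> + (- \<i>)) *\<^sub>C c"
        unfolding scaleC_add_left su by (simp add: u_def algebra_simps)
      then show ?thesis by (simp add: scaleC_zero_left scaleR_2)
    qed
    then have "2 *\<^sub>R \<rho> a = \<rho> u + star (\<rho> u)" by (metis h(1) h(4) h(6))
    then have "norm (2 *\<^sub>R \<rho> a) \<le> norm (\<rho> u) + norm (\<rho> u)"
      using norm_triangle_ineq[of "\<rho> u" "star (\<rho> u)"] by (simp add: norm_star)
    then show ?thesis using 1 by simp
  qed
  have sa: "norm (\<rho> a) \<le> norm a" if a: "star a = a" for a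
  proof (rule dense_ge)
    fix t assume t: "norm a < t"
    then have t0: "0 < t" by (rule order_le_less_trans[OF norm_ge_zero])
    have "norm (\<rho> ((1/t) *\<^sub>R a)) \<le> 1"
      by (rule sa1) (use t t0 a in \<open>simp_all add: star_scaleR\<close>)
    then show "norm (\<rho> a) \<le> t" using t0 by (simp add: h field_simps)
  qed
  have "(norm (\<rho> x))\<^sup>2 = norm (\<rho> (star x * x))" by (simp add: h cstar_identity)
  also have "\<dots> \<le> norm (star x * x)" by (rule sa) (simp add: star_mult star_star)
  also have "\<dots> = (norm x)\<^sup>2" by (rule cstar_identity)
  finally show ?thesis by (rule power2_le_imp_le) simp
qed

fun fword :: "('d \<Rightarrow> 'a::unital_cstar_algebra) \<Rightarrow> 'd starword \<Rightarrow> 'a" where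
  "fword b (Word l) = prod_list (map (\<lambda>(k, s). if s then star (b k) else b k) l)"

definition feval :: "('d \<Rightarrow> 'a::unital_cstar_algebra) \<Rightarrow> 'd free_star \<Rightarrow> 'a" where
  "feval b x = (\<Sum>w\<in>Poly_Mapping.keys x. Poly_Mapping.lookup x w *\<^sub>C fword b w)"

lemma fword_plus: "fword b (u + v) = fword b u * fword b v"
  by (cases u; cases v) (simp add: plus_starword_def)

lemma fword_zero: "fword b 0 = 1"
  by (simp add: zero_starword_def)

lemma fword_flip: "fword b (flip_word w) = star (fword b w)"
proof -
  have "fword b (flip_word (Word l)) = star (fword b (Word l))" for l
    by (induction l) (auto simp: flip_word_def star_one star_mult star_star)
  then show ?thesis by (cases w) simp
qed

lemma feval_superset:
  assumes "finite S" "Poly_Mapping.keys x \<subseteq> S"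
  shows "feval b x = (\<Sum>w\<in>S. Poly_Mapping.lookup x w *\<^sub>C fword b w)"
  unfolding feval_def using assms
  by (intro sum.mono_neutral_left) (auto simp: in_keys_iff scaleC_zero_left)

lemma feval_add: "feval b (x + y) = feval b x + feval b y"
proof -
  define S where "S = Poly_Mapping.keys x \<union> Poly_Mapping.keys y"
  have "finite S" "Poly_Mapping.keys x \<subseteq> S" "Poly_Mapping.keys y \<subseteq> S" "Poly_Mapping.keys (x + y) \<subseteq> S"
    using Poly_Mapping.keys_add[of x y] by (auto simp: S_def)
  then show ?thesis
    by (simp add: feval_superset[of S] lookup_add scaleC_add_left sum.distrib)
qed

lemma feval_single: "feval b (Poly_Mapping.single w c) = c *\<^sub>C fword b w"
  by (subst feval_superset[of "{w}"]) (auto simp: lookup_single)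

lemma feval_zero: "feval b 0 = 0"
  by (simp add: feval_def)

lemma feval_one: "feval b 1 = 1"
  using feval_single[of b 0 1] by (simp add: fword_zero scaleC_one)

lemma feval_mult: "feval b (x * y) = feval b x * feval b y"
proof (induction x rule: free_induct)
  case (add x w c)
  have "feval b (Poly_Mapping.single w c * y) = feval b (Poly_Mapping.single w c) * feval b y"
    by (induction y rule: free_induct)
       (simp_all add: feval_zero feval_add feval_single distrib_left mult_single fword_plus
         scaleC_mult_left scaleC_mult_right scaleC_scaleC mult.commute[of c])
  then show ?case using add by (simp add: distrib_right feval_add)
qed (simp add: feval_zero)

lemma feval_fstar: "feval b (fstar x) = star (feval b x)"
  by (induction x rule: free_induct)
     (simp_all add: feval_zero feval_add feval_single fstar_add fstar_single star_zero star_add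
       star_scaleC fword_flip)

lemma feval_fscale: "feval b (fscale c x) = c *\<^sub>C feval b x"
  by (simp add: fscale_def feval_mult feval_single fword_zero scaleC_mult_left)

lemma feval_diff: "feval b (x - y) = feval b x - feval b y"
  using feval_add[of b "x - y" y] by (simp add: eq_diff_eq)

lemma feval_fgen: "feval b (fgen k) = b k"
  by (simp add: fgen_def feval_single scaleC_one)

lemma feval_sum: "feval b (sum f S) = (\<Sum>k\<in>S. feval b (f k))"
  by (induction S rule: infinite_finite_induct) (simp_all add: feval_zero feval_add)

lemma feval_le:
  fixes b :: "'d::finite \<Rightarrow> 'a::unital_cstar_algebra"
  assumes "cuntz_relations b"
  shows "norm (feval b x) \<le> fnorm x"
proof (rule fnorm_upper[of "\<lambda>x. norm (feval b x)"])
  show "cuntz_seminorm (\<lambda>x. norm (feval b x))"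
    unfolding cuntz_seminorm_def cstar_seminorm_def using assms
    by (simp add: feval_add feval_fscale feval_mult feval_fstar feval_diff feval_one feval_fgen feval_sum
        norm_triangle_ineq norm_scaleC_alg norm_mult_ineq cstar_identity cuntz_relations_def)
qed

definition cuntz_hom :: "('d::finite \<Rightarrow> 'a::unital_cstar_algebra) \<Rightarrow> 'd cuntz \<Rightarrow> 'a" where
  "cuntz_hom b x = lim (\<lambda>n. feval b (rep_cuntz x n))"

lemma cuntz_hom_tendsto:
  fixes b :: "'d::finite \<Rightarrow> 'a::unital_cstar_algebra"
  assumes b: "cuntz_relations b" and X: "fcauchy X"
  shows "(\<lambda>n. feval b (X n)) \<longlonglongrightarrow> cuntz_hom b (abs_cuntz X)"
proof -
  define Y where "Y = rep_cuntz (abs_cuntz X)"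
  have "cuntz_rel X X" using X by (rule cuntz_rel_refl)
  then have "cuntz_rel Y X" unfolding Y_def by (rule Quotient_rep_abs[OF Quotient_cuntz])
  then have "(\<lambda>n. fnorm (Y n - X n)) \<longlonglongrightarrow> 0" by (simp add: cuntz_rel_def)
  then have 0: "(\<lambda>n. feval b (Y n) - feval b (X n)) \<longlonglongrightarrow> 0"
    by (rule Lim_null_comparison[rotated])
       (intro always_eventually allI, simp add: feval_le[OF b] flip: feval_diff)
  have "Cauchy (\<lambda>n. feval b (X n))"
  proof (rule CauchyI)
    fix e :: real assume "0 < e"
    then obtain N where N: "\<And>m n. m \<ge> N \<Longrightarrow> n \<ge> N \<Longrightarrow> fnorm (X m - X n) < e"
      using X unfolding fcauchy_def by blast
    have "norm (feval b (X m) - feval b (X n)) < e" if "m \<ge> N" "n \<ge> N" for m n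
      using N[OF that] feval_le[OF b, of "X m - X n"] by (simp add: feval_diff)
    then show "\<exists>M. \<forall>m\<ge>M. \<forall>n\<ge>M. norm (feval b (X m) - feval b (X n)) < e" by blast
  qed
  then obtain L where L: "(\<lambda>n. feval b (X n)) \<longlonglongrightarrow> L" by (auto dest!: Cauchy_convergent simp: convergent_def)
  have "(\<lambda>n. feval b (Y n)) \<longlonglongrightarrow> L" using tendsto_add[OF 0 L] by simp
  then have "cuntz_hom b (abs_cuntz X) = L" by (simp add: cuntz_hom_def Y_def limI)
  then show ?thesis using L by simp
qed

lemma star_hom_cuntz_hom:
  assumes b: "cuntz_relations b"
  shows "star_hom (cuntz_hom b)"
proof -
  have lim: "f \<longlonglongrightarrow> cuntz_hom b (abs_cuntz X)" if "fcauchy X" "\<And>n. f n = feval b (X n)" for f X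
    using cuntz_hom_tendsto[OF b that(1)] that(2) by presburger
  have "cuntz_hom b (x + y) = cuntz_hom b x + cuntz_hom b y"
    and "cuntz_hom b (x * y) = cuntz_hom b x * cuntz_hom b y"
    and "cuntz_hom b (c *\<^sub>C x) = c *\<^sub>C cuntz_hom b x"
    and "cuntz_hom b (star x) = star (cuntz_hom b x)"
    and "cuntz_hom b 1 = 1" for x y c
  proof -
    obtain X where X: "x = abs_cuntz X" "fcauchy X" by (cases x)
    obtain Y where Y: "y = abs_cuntz Y" "fcauchy Y" by (cases y)
    note s = X Y cuntz_abs_simps fcauchy_intros star_cuntz.abs_eq[OF cuntz_rel_refl]
    note tx = cuntz_hom_tendsto[OF b X(2)] and ty = cuntz_hom_tendsto[OF b Y(2)]
    show "cuntz_hom b (x + y) = cuntz_hom b x + cuntz_hom b y"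
      unfolding s(1,3) cuntz_abs_simps(1)[OF X(2) Y(2)]
      by (rule LIMSEQ_unique[OF lim tendsto_add[OF tx ty]]) (simp_all add: s feval_add)
    show "cuntz_hom b (x * y) = cuntz_hom b x * cuntz_hom b y"
      unfolding s(1,3) cuntz_abs_simps(4)[OF X(2) Y(2)]
      by (rule LIMSEQ_unique[OF lim tendsto_mult[OF tx ty]]) (simp_all add: s feval_mult)
    have bl: "bounded_linear (\<lambda>z :: 'b. c *\<^sub>C z)"
      by (rule bounded_linear_intro[of _ "cmod c"])
         (simp_all add: scaleC_add_right scaleR_scaleC scaleC_scaleC mult.commute norm_scaleC_alg)
    show "cuntz_hom b (c *\<^sub>C x) = c *\<^sub>C cuntz_hom b x"
      unfolding s(1) cuntz_abs_simps(5)[OF X(2)]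
      by (rule LIMSEQ_unique[OF lim bounded_linear.tendsto[OF bl tx]]) (simp_all add: s feval_fscale)
    show "cuntz_hom b (star x) = star (cuntz_hom b x)"
      unfolding s(1) star_cuntz.abs_eq[OF cuntz_rel_refl, OF X(2)]
      by (rule LIMSEQ_unique[OF lim bounded_linear.tendsto[OF bounded_linear_star tx]])
         (simp_all add: s feval_fstar)
    show "cuntz_hom b 1 = 1"
      unfolding cuntz_abs_simps(7) by (rule LIMSEQ_unique[OF lim tendsto_const]) (simp_all add: feval_one)
  qed
  then show ?thesis by (simp add: star_hom_def clinear_def)
qed

lemma star_hom_cembed:
  assumes "star_hom \<rho>" shows "\<rho> (cembed a) = feval (\<lambda>k. \<rho> (cgen k)) a"
proof -
  note h = star_hom_add[OF assms] star_hom_scaleC[OF assms] star_hom_mult[OF assms]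
    star_hom_star[OF assms] star_hom_one[OF assms]
  have z: "\<rho> 0 = 0" using h(1)[of 0 0] by simp
  define b where "b = (\<lambda>k. \<rho> (cgen k))"
  have word: "\<rho> (cembed (Poly_Mapping.single (Word l) 1)) = fword b (Word l)" for l
  proof (induction l)
    case Nil
    then show ?case by (simp add: h cembed_simps fword_zero flip: zero_starword_def del: fword.simps)
  next
    case (Cons ks l)
    obtain k s where ks: "ks = (k, s)" by fastforce
    have "\<rho> (cembed (Poly_Mapping.single (Word [(k, s)]) 1)) = (if s then star (b k) else b k)"
    proof (cases s)
      case True
      have "(Poly_Mapping.single (Word [(k, True)]) 1) = fstar (fgen k)"
        by (simp add: fgen_def fstar_single flip_word_def)
      then show ?thesis using True by (simp add: cembed_fstar h b_def flip: cgen_def)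
    qed (simp add: b_def cgen_def fgen_def)
    moreover have "(Poly_Mapping.single (Word (ks # l)) 1) =
        Poly_Mapping.single (Word [(k, s)]) 1 * Poly_Mapping.single (Word l) (1 :: complex)"
      by (simp add: mult_single plus_starword_def ks)
    ultimately show ?case using Cons by (simp add: cembed_simps h ks)
  qed
  have "\<rho> (cembed a) = feval b a"
  proof (induction a rule: free_induct)
    case zero
    then show ?case by (simp add: cembed_simps z feval_zero)
  next
    case (add x w c)
    have "Poly_Mapping.single w c = fscale c (Poly_Mapping.single w 1)" by (simp add: fscale_single)
    then have "\<rho> (cembed (Poly_Mapping.single w c)) = c *\<^sub>C fword b w"
      using word[of "letters w"] by (simp add: cembed_simps h)
    then show ?case using add by (simp add: cembed_simps h feval_add feval_single)
  qed
  then show ?thesis by (simp add: b_def)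
qed

theorem cuntz_universal:
  fixes b :: "'d::finite \<Rightarrow> 'b::unital_cstar_algebra"
  assumes b: "cuntz_relations b"
  shows "\<exists>!\<rho> :: 'd cuntz \<Rightarrow> 'b. star_hom \<rho> \<and> (\<forall>k. \<rho> (cgen k) = b k)"
proof (rule ex1I[of _ "cuntz_hom b"])
  have "cuntz_hom b (cgen k) = b k" for k
    unfolding cgen_def cembed_def
    by (rule LIMSEQ_unique[OF cuntz_hom_tendsto[OF b fcauchy_const]]) (simp add: feval_fgen)
  then show "star_hom (cuntz_hom b) \<and> (\<forall>k. cuntz_hom b (cgen k) = b k)"
    using star_hom_cuntz_hom[OF b] by blast
next
  fix \<rho> :: "'d cuntz \<Rightarrow> 'b" assume r: "star_hom \<rho> \<and> (\<forall>k. \<rho> (cgen k) = b k)"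
  then have rh: "star_hom \<rho>" by blast
  have bl: "bounded_linear \<rho>"
    by (rule bounded_linear_intro[of _ 1])
       (simp_all add: star_hom_add[OF rh] star_hom_scaleR[OF rh] star_hom_contractive[OF rh])
  show "\<rho> = cuntz_hom b"
  proof
    fix x :: "'d cuntz"
    obtain X where X: "x = abs_cuntz X" "fcauchy X" by (cases x)
    have "(\<lambda>n. \<rho> (cembed (X n))) \<longlonglongrightarrow> \<rho> x"
      unfolding X(1) by (rule bounded_linear.tendsto[OF bl cembed_tendsto[OF X(2)]])
    moreover have "\<rho> (cembed a) = feval b a" for a
      using star_hom_cembed[OF rh] r by simp
    ultimately show "\<rho> x = cuntz_hom b x"
      using cuntz_hom_tendsto[OF b X(2)] LIMSEQ_unique X(1) by simp blast
  qed
qed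

lemma cuntz_generated: "closure (range (feval (cgen :: 'd::finite \<Rightarrow> 'd cuntz))) = UNIV"
proof -
  have "star_hom (\<lambda>x :: 'd cuntz. x)" by (simp add: star_hom_def clinear_def)
  then have *: "cembed a = feval (cgen :: 'd \<Rightarrow> 'd cuntz) a" for a
    using star_hom_cembed[of "\<lambda>x. x" a] by simp
  have "x \<in> closure (range (feval (cgen :: 'd \<Rightarrow> 'd cuntz)))" for x
    unfolding closure_approachable
  proof (intro allI impI)
    fix e :: real assume "0 < e"
    then obtain a where "norm (x - cembed a) < e" using cembed_dense by blast
    then show "\<exists>y\<in>range (feval (cgen :: 'd \<Rightarrow> 'd cuntz)). dist y x < e"
      by (metis * dist_commute dist_norm rangeI)
  qed
  then show ?thesis by auto
qed

section \<open>Representations and similarities\<close>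

definition cuntz_reps :: "('d::finite cuntz \<Rightarrow> 'h::chilbert_space bop) set" where
  "cuntz_reps = {\<rho>. star_hom \<rho>}"

definition similarities :: "('h::chilbert_space \<Rightarrow> 'h ^ 'd::finite) set" where
  "similarities = {\<psi>. clinear \<psi> \<and> (\<forall>\<xi>. norm (\<psi> \<xi>) = norm \<xi>) \<and> surj \<psi>}"

definition tau :: "('d::finite cuntz \<Rightarrow> 'h::chilbert_space bop) \<Rightarrow> 'h \<Rightarrow> 'h ^ 'd" where
  "tau \<rho> \<xi> = (\<chi> k. bop_apply (\<rho> (star (cgen k))) \<xi>)"

definition similarity_op :: "('h::chilbert_space \<Rightarrow> 'h ^ 'd::finite) \<Rightarrow> 'd \<Rightarrow> 'h \<Rightarrow> 'h" where
  "similarity_op \<psi> k \<xi> = inv \<psi> (axis k \<xi>)"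

end

theory Submission
  imports Defs
begin

text \<open>
  For a Cuntz family \<open>S\<close> of operators, \<open>\<Sum>\<^sub>k S\<^sub>k S\<^sub>k\<^sup>* = 1\<close> says exactly that
  \<open>\<psi> = (S\<^sub>1\<^sup>*, \<dots>, S\<^sub>d\<^sup>*)\<close> is isometric. Comparing the norm of \<open>\<psi> (S\<^sub>k \<xi>)\<close> with that
  of its \<open>k\<close>th coordinate \<open>S\<^sub>k\<^sup>* S\<^sub>k \<xi> = \<xi>\<close> shows that the remaining coordinates vanish, so \<open>\<psi> \<circ> S\<^sub>k\<close> is
  the \<open>k\<close>th inclusion; hence \<open>\<psi>\<close> is surjective and \<open>S\<^sub>k\<close> is recovered from \<open>\<psi>\<close>. Conversely, a
  similarity carries the inclusions into \<open>H\<^sup>d\<close> to a Cuntz family, and representations of the Cuntz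
  algebra correspond to Cuntz families by universality.
\<close>

lemma bop_apply_one: "bop_apply 1 \<xi> = \<xi>"
  by transfer simp

lemma bop_apply_mult: "bop_apply (S * T) \<xi> = bop_apply S (bop_apply T \<xi>)"
  by transfer simp

lemma bop_apply_plus: "bop_apply (S + T) \<xi> = bop_apply S \<xi> + bop_apply T \<xi>"
  by transfer (simp add: blinfun.add_left)

lemma bop_apply_zero: "bop_apply 0 \<xi> = 0"
  by transfer simp

lemma bop_apply_sum: "bop_apply (sum S A) \<xi> = (\<Sum>k\<in>A. bop_apply (S k) \<xi>)"
  by (induction A rule: infinite_finite_induct) (simp_all add: bop_apply_zero bop_apply_plus)

lemma bop_apply_add: "bop_apply S (\<xi> + \<eta>) = bop_apply S \<xi> + bop_apply S \<eta>"
  by transfer (simp add: blinfun.add_right)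

lemma bop_apply_scaleC: "bop_apply S (c *\<^sub>C \<xi>) = c *\<^sub>C bop_apply S \<xi>"
  by transfer simp

text \<open>\<open>star\<close> is built from the adjoint for the real inner product
  \<open>inner\<close>, so all adjoint computations below stay with \<open>inner\<close>.\<close>

lemma inner_bop_apply: "inner (bop_apply S \<xi>) \<eta> = inner \<xi> (bop_apply (star S) \<eta>)"
  by transfer (rule adj_blinfun)

lemma inner_bop_apply_right: "inner \<xi> (bop_apply S \<eta>) = inner (bop_apply (star S) \<xi>) \<eta>"
  by (metis inner_bop_apply inner_commute)

lemma bop_exists:
  assumes "clinear f" and "\<And>\<xi>. norm (f \<xi>) \<le> norm \<xi> * K"
  shows "\<exists>S. bop_apply S = f"
proof -
  have "bounded_linear f"
    using assms by (intro bounded_linear_intro[of _ K]) (simp_all add: clinear_def scaleR_scaleC)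
  then have "bop_apply (Abs_bop (Blinfun f)) = f"
    using assms(1)
    by (simp add: bop_apply.rep_eq Abs_bop_inverse bounded_linear_Blinfun_apply clinear_def)
  then show ?thesis by blast
qed

lemma clinear_sum:
  assumes "clinear f"
  shows "f (sum g A) = (\<Sum>k\<in>A. f (g k))"
proof -
  have "f 0 = 0" using assms unfolding clinear_def by (metis add_cancel_left_right)
  then show ?thesis
    using assms by (induction A rule: infinite_finite_induct) (simp_all add: clinear_def)
qed

lemma sum_axis: "(\<Sum>k\<in>UNIV. axis k (x $ k)) = (x :: 'a::comm_monoid_add ^ 'd::finite)"
  by (simp add: vec_eq_iff axis_def if_distrib[of "\<lambda>v. v $ _"] sum.delta cong: if_cong)

lemma norm_axis: "norm (axis k \<xi>) = norm (\<xi> :: 'a::real_inner)"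
  unfolding norm_eq_sqrt_inner inner_axis by (simp add: axis_def)

text \<open>Polarization: \<open>dot_norm\<close> expresses the inner product through the norms of
  \<open>x + y\<close>, \<open>x\<close> and \<open>y\<close>.\<close>

lemma isometry_inner:
  fixes f :: "'a::real_inner \<Rightarrow> 'b::real_inner"
  assumes add: "\<And>x y. f (x + y) = f x + f y" and norm: "\<And>x. norm (f x) = norm x"
  shows "inner (f x) (f y) = inner x y"
  by (simp add: dot_norm norm flip: add)

text \<open>\<open>tau\<close> depends only on the images of the generators. Working with a bare
  family \<open>S\<close> separates the operator theory from the Cuntz algebra.\<close>

definition adjoint_tuple :: "('d \<Rightarrow> 'h::chilbert_space bop) \<Rightarrow> 'h \<Rightarrow> 'h ^ 'd::finite" where
  "adjoint_tuple S \<xi> = (\<chi> k. bop_apply (star (S k)) \<xi>)"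

lemma norm_adjoint_tuple:
  assumes "cuntz_relations S"
  shows "norm (adjoint_tuple S \<xi>) = norm \<xi>"
proof -
  have "inner (adjoint_tuple S \<xi>) (adjoint_tuple S \<xi>) = inner \<xi> (bop_apply (\<Sum>k\<in>UNIV. S k * star (S k)) \<xi>)"
    by (simp add: adjoint_tuple_def inner_vec_def bop_apply_sum bop_apply_mult inner_sum_right
        inner_bop_apply_right)
  then show ?thesis
    using assms by (simp add: cuntz_relations_def bop_apply_one norm_eq_sqrt_inner)
qed

lemma adjoint_tuple_generator:
  assumes "cuntz_relations S"
  shows "adjoint_tuple S (bop_apply (S k) \<xi>) = axis k \<xi>"
proof -
  define x where "x = adjoint_tuple S (bop_apply (S k) \<xi>)"
  have s: "star (S k) * S k = 1" using assms by (simp add: cuntz_relations_def)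
  have xk: "x $ k = \<xi>"
    using s by (simp add: x_def adjoint_tuple_def bop_apply_one flip: bop_apply_mult)
  have "inner (bop_apply (S k) \<xi>) (bop_apply (S k) \<xi>) = inner \<xi> \<xi>"
    using s by (simp add: inner_bop_apply bop_apply_one flip: bop_apply_mult)
  then have "norm x = norm \<xi>"
    unfolding x_def norm_adjoint_tuple[OF assms] by (simp add: norm_eq_sqrt_inner)
  then have "(\<Sum>j\<in>UNIV. (norm (x $ j))\<^sup>2) = (norm \<xi>)\<^sup>2"
    by (simp add: power2_norm_eq_inner norm_eq inner_vec_def)
  then have "(\<Sum>j\<in>UNIV - {k}. (norm (x $ j))\<^sup>2) = 0"
    using xk by (simp add: sum.remove[of UNIV k])
  then have "x $ j = 0" if "j \<noteq> k" for j
    using that by (simp add: sum_nonneg_eq_0_iff)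
  then show ?thesis using xk by (auto simp: x_def[symmetric] vec_eq_iff axis_def)
qed

lemma clinear_adjoint_tuple: "clinear (adjoint_tuple S)"
  by (simp add: clinear_def adjoint_tuple_def vec_eq_iff bop_apply_add bop_apply_scaleC scaleC_vec_def)

lemma adjoint_tuple_similarity:
  assumes "cuntz_relations S"
  shows "adjoint_tuple S \<in> similarities"
proof -
  \<comment> \<open>An explicit preimage: \<open>S k\<close> applied to the kth coordinate of
    \<open>y\<close> is mapped to that coordinate's axis vector, and these add up to
    \<open>y\<close>.\<close>
  have "adjoint_tuple S (\<Sum>k\<in>UNIV. bop_apply (S k) (y $ k)) = y" for y
    by (simp add: clinear_sum[OF clinear_adjoint_tuple] adjoint_tuple_generator[OF assms] sum_axis)
  then have "surj (adjoint_tuple S)" by (rule surjI)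
  then show ?thesis
    by (simp add: similarities_def clinear_adjoint_tuple norm_adjoint_tuple[OF assms])
qed

lemma similarity_inj:
  assumes "\<psi> \<in> similarities"
  shows "inj \<psi>"
proof (rule injI)
  fix x y assume e: "\<psi> x = \<psi> y"
  have add: "\<psi> (u + v) = \<psi> u + \<psi> v" and norm: "norm (\<psi> u) = norm u" for u v
    using assms by (auto simp: similarities_def clinear_def)
  have "\<psi> (x - y) = 0" using add[of "x - y" y] e by simp
  then show "x = y" using norm[of "x - y"] by simp
qed

text \<open>Read \<open>adjoint_tuple_generator\<close> backwards inside
  \<open>similarity_op\<close>; injectivity then lets \<open>inv\<close> cancel.\<close>

lemma similarity_op_adjoint_tuple:
  assumes "cuntz_relations S"
  shows "similarity_op (adjoint_tuple S) k = bop_apply (S k)"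
  by (rule ext)
     (simp add: similarity_op_def inv_f_f[OF similarity_inj[OF adjoint_tuple_similarity[OF assms]]]
       flip: adjoint_tuple_generator[OF assms])

lemma similarity_cuntz_family:
  fixes \<psi> :: "'h::chilbert_space \<Rightarrow> 'h ^ 'd::finite"
  assumes \<psi>: "\<psi> \<in> similarities"
  obtains S where "cuntz_relations S" "\<And>k. bop_apply (S k) = similarity_op \<psi> k" "adjoint_tuple S = \<psi>"
proof -
  have lin: "clinear \<psi>" and norm: "norm (\<psi> u) = norm u" and surj: "surj \<psi>" for u
    using \<psi> by (auto simp: similarities_def)
  have add: "\<psi> (u + v) = \<psi> u + \<psi> v" and scale: "\<psi> (c *\<^sub>C u) = c *\<^sub>C \<psi> u" for u v c
    using lin by (auto simp: clinear_def)
  have op: "\<psi> (similarity_op \<psi> k u) = axis k u" for k u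
    by (simp add: similarity_op_def surj_f_inv_f[OF surj])
  note inj = injD[OF similarity_inj[OF \<psi>]]
  have "\<exists>S. bop_apply S = similarity_op \<psi> k" for k
  proof (rule bop_exists)
    \<comment> \<open>It suffices to compare both sides after the injective \<psi>, where
      \<open>similarity_op\<close> becomes the linear map \<open>axis k\<close>.\<close>
    show "clinear (similarity_op \<psi> k)"
      unfolding clinear_def
      by (intro conjI allI; rule inj)
         (simp_all add: op add scale vec_eq_iff axis_def scaleC_vec_def scaleC_zero_right)
    show "norm (similarity_op \<psi> k u) \<le> norm u * 1" for u
      using norm[of "similarity_op \<psi> k u"] by (simp add: op norm_axis)
  qed
  then obtain S where S: "\<And>k. bop_apply (S k) = similarity_op \<psi> k" by metis
  \<comment> \<open>\<psi> preserves inner products and carries \<open>S k\<close> to the kth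
    inclusion, whose adjoint is the kth coordinate projection.\<close>
  have adj: "bop_apply (star (S k)) u = \<psi> u $ k" for k u
  proof (rule vector_eq_rdot[THEN iffD1], rule allI)
    fix v
    have "inner v (bop_apply (star (S k)) u) = inner (\<psi> (similarity_op \<psi> k v)) (\<psi> u)"
      by (simp add: isometry_inner[OF add norm] S flip: inner_bop_apply)
    also have "\<dots> = inner v (\<psi> u $ k)"
      unfolding op by (metis inner_axis inner_commute)
    finally show "inner (bop_apply (star (S k)) u) v = inner (\<psi> u $ k) v"
      by (simp add: inner_commute)
  qed
  have "star (S k) * S k = 1" for k
    by (rule bop_eqI) (simp add: bop_apply_mult bop_apply_one adj S op)
  \<comment> \<open>After \<psi> the left side at \<open>u\<close> is the sum of the axis vectors of
    the coordinates of \<open>\<psi> u\<close>.\<close>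
  moreover have "(\<Sum>k\<in>UNIV. S k * star (S k)) = 1"
    by (rule bop_eqI, rule inj)
       (simp add: bop_apply_sum bop_apply_mult bop_apply_one adj S clinear_sum[OF lin] op sum_axis)
  ultimately have "cuntz_relations S" by (simp add: cuntz_relations_def)
  moreover have "adjoint_tuple S = \<psi>"
    by (rule ext) (simp add: adjoint_tuple_def adj)
  ultimately show ?thesis using that S by blast
qed

lemma star_hom_cuntz_relations:
  assumes "star_hom \<rho>"
  shows "cuntz_relations (\<lambda>k. \<rho> (cgen k))"
proof -
  note h = star_hom_mult[OF assms] star_hom_star[OF assms]
  have sum: "\<rho> (sum f A) = (\<Sum>k\<in>A. \<rho> (f k))" for f :: "'a \<Rightarrow> 'a cuntz" and A
    using assms by (intro clinear_sum) (simp add: star_hom_def)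
  show ?thesis
    using cuntz_relations_cgen[where 'd='a]
    by (simp add: cuntz_relations_def star_hom_one[OF assms] flip: h sum)
qed

lemma tau_eq_adjoint_tuple:
  assumes "star_hom \<rho>"
  shows "tau \<rho> = adjoint_tuple (\<lambda>k. \<rho> (cgen k))"
  by (rule ext) (simp add: tau_def adjoint_tuple_def star_hom_star[OF assms])

theorem proposition3p1:
  assumes "2 \<le> CARD('d::finite)"
    and "\<not> (\<exists>B :: 'h::chilbert_space set. finite B \<and> cspan B = UNIV)"
  shows "bij_betw (tau :: ('d cuntz \<Rightarrow> 'h bop) \<Rightarrow> 'h \<Rightarrow> 'h ^ 'd) cuntz_reps similarities \<and>
    (\<forall>\<psi> \<in> (similarities :: ('h \<Rightarrow> 'h ^ 'd) set).
       (\<exists>!\<rho>. \<rho> \<in> cuntz_reps \<and> (\<forall>k. bop_apply (\<rho> (cgen k)) = similarity_op \<psi> k)) \<and>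
       inv_into cuntz_reps tau \<psi> \<in> cuntz_reps \<and>
       (\<forall>k. bop_apply (inv_into cuntz_reps tau \<psi> (cgen k)) = similarity_op \<psi> k))"
proof -
  note rel = star_hom_cuntz_relations and tau = tau_eq_adjoint_tuple
  have op: "bop_apply (\<rho> (cgen k)) = similarity_op (tau \<rho>) k"
    if "\<rho> \<in> cuntz_reps" for \<rho> :: "'d cuntz \<Rightarrow> 'h bop" and k
    using that by (simp add: cuntz_reps_def tau similarity_op_adjoint_tuple[OF rel])
  have ex1: "\<exists>!\<rho>. \<rho> \<in> cuntz_reps \<and> (\<forall>k. bop_apply (\<rho> (cgen k)) = similarity_op \<psi> k)"
    and ex: "\<exists>\<rho>\<in>cuntz_reps. tau \<rho> = \<psi>"
    if \<psi>: "\<psi> \<in> similarities" for \<psi> :: "'h \<Rightarrow> 'h ^ 'd"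
  proof -
    obtain S where S: "cuntz_relations S" "\<And>k. bop_apply (S k) = similarity_op \<psi> k"
        "adjoint_tuple S = \<psi>"
      using similarity_cuntz_family[OF \<psi>] by blast
    \<comment> \<open>This turns the prescribed actions on vectors into the form required by
      \<open>cuntz_universal\<close>.\<close>
    have eq: "(\<forall>k. bop_apply (\<rho> (cgen k)) = similarity_op \<psi> k) \<longleftrightarrow> (\<forall>k. \<rho> (cgen k) = S k)"
      for \<rho> :: "'d cuntz \<Rightarrow> 'h bop"
      by (metis S(2) bop_eqI)
    show "\<exists>!\<rho>. \<rho> \<in> cuntz_reps \<and> (\<forall>k. bop_apply (\<rho> (cgen k)) = similarity_op \<psi> k)"
      using cuntz_universal[OF S(1)] by (simp add: eq cuntz_reps_def)
    obtain \<rho> :: "'d cuntz \<Rightarrow> 'h bop" where "star_hom \<rho>" "\<And>k. \<rho> (cgen k) = S k"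
      using cuntz_universal[OF S(1)] by blast
    then show "\<exists>\<rho>\<in>cuntz_reps. tau \<rho> = \<psi>"
      using S(3) by (auto simp: cuntz_reps_def tau)
  qed
  have mem: "tau \<rho> \<in> similarities" if "\<rho> \<in> cuntz_reps" for \<rho> :: "'d cuntz \<Rightarrow> 'h bop"
    using that by (simp add: cuntz_reps_def tau adjoint_tuple_similarity[OF rel])
  have "bij_betw (tau :: ('d cuntz \<Rightarrow> 'h bop) \<Rightarrow> 'h \<Rightarrow> 'h ^ 'd) cuntz_reps similarities"
    unfolding bij_betw_def
  proof
    show "inj_on (tau :: ('d cuntz \<Rightarrow> 'h bop) \<Rightarrow> 'h \<Rightarrow> 'h ^ 'd) cuntz_reps"
      \<comment> \<open>By \<open>op\<close>, two representations with the same \<open>tau\<close>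
        satisfy the same condition in \<open>ex1\<close>, hence coincide.\<close>
      by (rule inj_onI) (metis ex1[OF mem] op)
    show "tau ` (cuntz_reps :: ('d cuntz \<Rightarrow> 'h bop) set) = similarities"
      using mem ex by fast
  qed
  moreover have "inv_into cuntz_reps tau \<psi> \<in> cuntz_reps"
    and "bop_apply (inv_into cuntz_reps tau \<psi> (cgen k)) = similarity_op \<psi> k"
    if "\<psi> \<in> similarities" for \<psi> :: "'h \<Rightarrow> 'h ^ 'd" and k
  proof -
    \<comment> \<open>\<open>inv_into\<close> is a true preimage only on the image of
      \<open>tau\<close>, so surjectivity enters first; \<open>op\<close> at this preimage then
      gives the formula.\<close>
    have "\<psi> \<in> tau ` cuntz_reps" using ex[OF that] by blast
    then show *: "inv_into cuntz_reps tau \<psi> \<in> cuntz_reps" by (rule inv_into_into)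
    show "bop_apply (inv_into cuntz_reps tau \<psi> (cgen k)) = similarity_op \<psi> k"
      unfolding op[OF *] f_inv_into_f[OF \<open>\<psi> \<in> tau ` cuntz_reps\<close>] ..
  qed
  ultimately show ?thesis using ex1 by blast
qed

end
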